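(* Let $\Bbbk$ be a field of characteristic different from $2$. The Kac--Paljutkin Hopf algebra $H_8$ has no non-zero infinitesimal $\mathcal{R}$-matrices: for every quasitriangular structure $\mathcal{R}$ on $H_8$, if $\chi$ is an infinitesimal $\mathcal{R}$-matrix for $(H_8,\mathcal{R})$, then $\chi=0$.
   Context: $H_8$ is the $8$-dimensional Hopf algebra generated as an algebra by $x,y,z$ with relations $x^2=1$, $y^2=1$, $xy=yx$, $zx=yz$, $zy=xz$, $z^2=\frac12(1+x+y-xy)$, and with $\Delta(x)=x\otimes x$, $\Delta(y)=y\otimes y$, $\Delta(z)=\frac12(z\otimes z)(1\otimes 1+y\otimes 1+1\otimes x-y\otimes x)$, $\varepsilon(x)=\varepsilon(y)=\varepsilon(z)=1$, $S(x)=x$, $S(y)=y$, $S(z)=z$. For a bialgebra $H$ and $T=\sum_i T^i\otimes T_i\in H\otimes H$ write $T_{12}=T\otimes 1$, $T_{23}=1\otimes T$, $T_{13}=\sum_i T^i\otimes 1\otimes T_i$. A quasitriangular structure (universal $\mathcal{R}$-matrix) on $H$ is an invertible $\mathcal{R}\in H\otimes H$ with $\Delta^{\mathrm{op}}(h)=\mathcal{R}\Delta(h)\mathcal{R}^{-1}$ for all $h$, $(\mathrm{Id}\otimes\Delta)(\mathcal{R})=\mathcal{R}_{13}\mathcal{R}_{12}$, $(\Delta\otimes\mathrm{Id})(\mathcal{R})=\mathcal{R}_{13}\mathcal{R}_{23}$. An infinitesimal $\mathcal{R}$-matrix for $(H,\mathcal{R})$ is $\chi\in H\otimes H$ such that $\chi\Delta(h)=\Delta(h)\chi$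 for all $h\in H$, $(\mathrm{Id}\otimes\Delta)(\chi)=\chi_{12}+\mathcal{R}_{12}^{-1}\chi_{13}\mathcal{R}_{12}$, and $(\Delta\otimes\mathrm{Id})(\chi)=\chi_{23}+\mathcal{R}_{23}^{-1}\chi_{13}\mathcal{R}_{23}$. *)

theory Defs
  imports "HOL-Library.Poly_Mapping"
begin

section \<open>Fields of characteristic different from 2\<close>

class field_char_ne_2 = field +
  assumes char_ne_2: "CHAR('a) \<noteq> 2"
begin

lemma two_ne_0: "(2::'a) \<noteq> 0"
proof
  assume "(2::'a) = 0"
  then have "of_nat 2 = (0::'a)" by simp
  then have "CHAR('a) dvd 2" by (simp only: of_nat_eq_0_iff_char_dvd)
  then have "CHAR('a) \<le> 2" by (rule dvd_imp_le) simp
  moreover have "CHAR('a) \<noteq> 0"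
  proof
    assume "CHAR('a) = 0"
    with \<open>CHAR('a) dvd 2\<close> have "(0::nat) dvd 2" by simp
    then show False by simp
  qed
  moreover have "CHAR('a) \<noteq> Suc 0" using CHAR_not_1' by blast
  ultimately show False using char_ne_2 by linarith
qed

lemma half_double: "1/2 + 1/2 = (1::'a)"
  using two_ne_0 by (simp add: field_simps)

end

instance field_char_0 \<subseteq> field_char_ne_2
  by standard simp


section \<open>Linear extension, ideals and spans in monoid algebras\<close>

text \<open>For a monoid \<open>M\<close>, written additively as the library requires, the type
  \<open>'m \<Rightarrow>\<^sub>0 'k\<close> is the monoid algebra \<open>k[M]\<close>; the basis element of
  \<open>m\<close> is \<open>single m 1\<close>, and \<open>single 0 c\<close> is the scalar \<open>c\<close>.
  A \<open>k\<close>-algebra structure on a ring is given by its structure map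
  \<open>\<iota> :: 'k \<Rightarrow> 'a\<close> with central image.\<close>

abbreviation single :: "'m \<Rightarrow> 'k \<Rightarrow> 'm \<Rightarrow>\<^sub>0 'k::zero" where
  "single \<equiv> Poly_Mapping.single"

definition lin_ext :: "('k::zero \<Rightarrow> 'a::ring_1) \<Rightarrow> ('m \<Rightarrow> 'a) \<Rightarrow> ('m \<Rightarrow>\<^sub>0 'k) \<Rightarrow> 'a" where
  "lin_ext \<iota> f p = (\<Sum>m\<in>Poly_Mapping.keys p. \<iota> (Poly_Mapping.lookup p m) * f m)"

inductive_set two_sided_ideal :: "'r::ring_1 set \<Rightarrow> 'r set" for G where
  zero: "0 \<in> two_sided_ideal G"
| gen: "g \<in> G \<Longrightarrow> g \<in> two_sided_ideal G"
| add: "p \<in> two_sided_ideal G \<Longrightarrow> q \<in> two_sided_ideal G \<Longrightarrow> p + q \<in> two_sided_ideal G"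
| mult_left: "p \<in> two_sided_ideal G \<Longrightarrow> r * p \<in> two_sided_ideal G"
| mult_right: "p \<in> two_sided_ideal G \<Longrightarrow> p * r \<in> two_sided_ideal G"

inductive_set lin_span :: "('m::monoid_add \<Rightarrow>\<^sub>0 'k::ring_1) set \<Rightarrow> ('m \<Rightarrow>\<^sub>0 'k) set" for G where
  zero: "0 \<in> lin_span G"
| gen: "g \<in> G \<Longrightarrow> g \<in> lin_span G"
| add: "p \<in> lin_span G \<Longrightarrow> q \<in> lin_span G \<Longrightarrow> p + q \<in> lin_span G"
| scale: "p \<in> lin_span G \<Longrightarrow> single 0 c * p \<in> lin_span G"

lemma pm_induct [case_names zero add]:
  assumes "P 0" "\<And>p m c. P p \<Longrightarrow> P (p + single m c)"
  shows "P (p :: 'm \<Rightarrow>\<^sub>0 'k::comm_monoid_add)"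
proof (induction p rule: update_induct)
  case const
  then show ?case using assms(1) by simp
next
  case (update f a b)
  have "Poly_Mapping.update a b f = f + single a b"
    using update(1) by (intro poly_mapping_eqI)
      (auto simp: lookup_update lookup_add lookup_single when_def in_keys_iff)
  then show ?case using assms(2)[OF update(3)] by simp
qed

locale scalar_map =
  fixes \<iota> :: "'k::field \<Rightarrow> 'a::ring_1"
  assumes \<iota>_add: "\<iota> (c + d) = \<iota> c + \<iota> d"
    and \<iota>_mult: "\<iota> (c * d) = \<iota> c * \<iota> d"
    and \<iota>_one: "\<iota> 1 = 1"
    and \<iota>_central: "\<iota> c * a = a * \<iota> c"
begin

lemma \<iota>_zero: "\<iota> 0 = 0" by (metis \<iota>_add add_cancel_right_right)
lemma \<iota>_minus: "\<iota> (- c) = - \<iota> c" 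
  by (rule minus_unique[symmetric]) (simp add: \<iota>_zero flip: \<iota>_add)

lemma ext_zero [simp]: "lin_ext \<iota> f 0 = 0" by (simp add: lin_ext_def)

lemma ext_single [simp]: "lin_ext \<iota> f (single m c) = \<iota> c * f m"
  by (simp add: lin_ext_def \<iota>_zero)

lemma ext_add: "lin_ext \<iota> f (p + q) = lin_ext \<iota> f p + lin_ext \<iota> f q"
  unfolding lin_ext_def
  by (rule setsum_keys_plus_distrib[where f = "\<lambda>m c. \<iota> c * f m"])
    (simp_all add: \<iota>_zero \<iota>_add algebra_simps)

lemma ext_minus: "lin_ext \<iota> f (- p) = - lin_ext \<iota> f p"
  by (rule minus_unique[symmetric]) (simp flip: ext_add)

lemma ext_diff: "lin_ext \<iota> f (p - q) = lin_ext \<iota> f p - lin_ext \<iota> f q"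
  using ext_add[of f p "- q"] by (simp add: ext_minus)

lemma swap: "\<iota> c * a * (\<iota> d * b) = \<iota> (c * d) * (a * b)"
  by (metis \<iota>_central \<iota>_mult mult.assoc)

lemma ext_mult_single:
  assumes "\<And>m n. f (m + n) = f m * f n"
  shows "lin_ext \<iota> f (single m c * q) = lin_ext \<iota> f (single m c) * lin_ext \<iota> f q"
  by (induction q rule: pm_induct)
    (simp_all add: distrib_left ext_add mult_single assms swap)

lemma ext_mult:
  assumes "\<And>m n. f (m + n) = f m * f n"
  shows "lin_ext \<iota> f (p * q) = lin_ext \<iota> f p * lin_ext \<iota> f q"
  by (induction p rule: pm_induct)
    (simp_all add: distrib_right ext_add ext_mult_single[of f, OF assms] del: ext_single)

lemma ext_anti_single:
  assumes "\<And>m n. f (m + n) = f n * f m"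
  shows "lin_ext \<iota> f (single m c * q) = lin_ext \<iota> f q * lin_ext \<iota> f (single m c)"
  by (induction q rule: pm_induct)
    (simp_all add: distrib_left distrib_right ext_add mult_single assms swap mult.commute)

lemma ext_anti:
  assumes "\<And>m n. f (m + n) = f n * f m"
  shows "lin_ext \<iota> f (p * q) = lin_ext \<iota> f q * lin_ext \<iota> f p"
  by (induction p rule: pm_induct)
    (simp_all add: distrib_left distrib_right ext_add ext_anti_single[of f, OF assms] del: ext_single)

lemma ext_scale:
  fixes f :: "'m::monoid_add \<Rightarrow> 'a"
  shows "lin_ext \<iota> f (single 0 c * p) = \<iota> c * lin_ext \<iota> f p"
  by (induction p rule: pm_induct)
    (simp_all add: distrib_left ext_add mult_single \<iota>_mult mult.assoc)

lemma ext_fun_add: "lin_ext \<iota> (\<lambda>m. f m + g m) p = lin_ext \<iota> f p + lin_ext \<iota> g p"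
  by (simp add: lin_ext_def distrib_left sum.distrib)

lemma ext_fun_scale: "lin_ext \<iota> (\<lambda>m. \<iota> c * f m) p = \<iota> c * lin_ext \<iota> f p"
  by (simp add: lin_ext_def sum_distrib_left) (metis \<iota>_central mult.assoc)

lemma ext_ideal:
  assumes "\<And>m n. f (m + n) = f m * f n" "\<And>g. g \<in> G \<Longrightarrow> lin_ext \<iota> f g = 0"
    "p \<in> two_sided_ideal G"
  shows "lin_ext \<iota> f p = 0"
  using assms(3) by induction (simp_all add: assms(2) ext_add ext_mult[of f, OF assms(1)])

lemma ext_ideal_anti:
  assumes "\<And>m n. f (m + n) = f n * f m" "\<And>g. g \<in> G \<Longrightarrow> lin_ext \<iota> f g = 0"
    "p \<in> two_sided_ideal G"
  shows "lin_ext \<iota> f p = 0"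
  using assms(3) by induction (simp_all add: assms(2) ext_add ext_anti[of f, OF assms(1)])

lemma ext_span:
  assumes "\<And>g. g \<in> G \<Longrightarrow> lin_ext \<iota> f g = 0" "p \<in> lin_span G"
  shows "lin_ext \<iota> f p = 0"
  using assms(2) by induction (simp_all add: assms(1) ext_add ext_scale)

end

interpretation field_scalars: scalar_map "\<lambda>c::'k::field. c"
  by unfold_locales (simp_all add: algebra_simps)

definition is_ideal :: "'r::ring_1 set \<Rightarrow> bool" where
  "is_ideal I \<longleftrightarrow> 0 \<in> I \<and> (\<forall>p\<in>I. \<forall>q\<in>I. p + q \<in> I) \<and> (\<forall>p\<in>I. \<forall>r. r * p \<in> I \<and> p * r \<in> I)"

lemma two_sided_ideal_is_ideal: "is_ideal (two_sided_ideal G)"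
  by (auto simp: is_ideal_def intro: two_sided_ideal.intros)

lemma ideal_uminus: "is_ideal I \<Longrightarrow> p \<in> I \<Longrightarrow> - p \<in> I"
  unfolding is_ideal_def by (metis mult_minus_left mult_1)

lemma ideal_equivp: assumes "is_ideal I" shows "equivp (\<lambda>p q. p - q \<in> I)"
proof (rule equivpI)
  show "reflp (\<lambda>p q. p - q \<in> I)" using assms by (auto intro!: reflpI simp: is_ideal_def)
  show "symp (\<lambda>p q. p - q \<in> I)"
    by (rule sympI) (metis ideal_uminus[OF assms] minus_diff_eq)
  show "transp (\<lambda>p q. p - q \<in> I)"
  proof (rule transpI)
    fix p q r assume "p - q \<in> I" "q - r \<in> I"
    then have "(p - q) + (q - r) \<in> I" using assms by (auto simp only: is_ideal_def)
    then show "p - r \<in> I" by simp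
  qed
qed

lemma ideal_cong_add:
  assumes "is_ideal I" "p - p' \<in> I" "q - q' \<in> I" shows "(p + q) - (p' + q') \<in> I"
proof -
  have "(p - p') + (q - q') \<in> I" using assms unfolding is_ideal_def by blast
  then show ?thesis by (simp add: algebra_simps)
qed

lemma ideal_cong_minus:
  assumes "is_ideal I" "p - p' \<in> I" shows "(- p) - (- p') \<in> I"
  using ideal_uminus[OF assms] by simp

lemma ideal_cong_diff:
  assumes "is_ideal I" "p - p' \<in> I" "q - q' \<in> I" shows "(p - q) - (p' - q') \<in> I"
  using ideal_cong_add[OF assms(1,2) ideal_cong_minus[OF assms(1,3)]] by simp

lemma ideal_cong_mult:
  assumes "is_ideal I" "p - p' \<in> I" "q - q' \<in> I" shows "(p * q) - (p' * q') \<in> I"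
proof -
  have "(p - p') * q + p' * (q - q') \<in> I" using assms unfolding is_ideal_def by blast
  then show ?thesis by (simp add: algebra_simps)
qed

lemma span_is_ideal:
  fixes G :: "('m::monoid_add \<Rightarrow>\<^sub>0 'k::field) set"
  assumes l: "\<And>g m. g \<in> G \<Longrightarrow> single m 1 * g \<in> lin_span G"
    and r: "\<And>g m. g \<in> G \<Longrightarrow> g * single m 1 \<in> lin_span G"
  shows "is_ideal (lin_span G)"
proof -
  have sc: "p * single 0 c = single 0 c * p" for p :: "'m \<Rightarrow>\<^sub>0 'k" and c
    by (induction p rule: pm_induct) (simp_all add: algebra_simps mult_single)
  have L1: "single m 1 * p \<in> lin_span G" if "p \<in> lin_span G" for p m
    using that
  proof induction
    case (scale p c)
    have "single m 1 * (single 0 c * p) = single 0 c * (single m 1 * p)"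
      by (metis mult.assoc sc)
    then show ?case using scale by (simp add: lin_span.scale)
  qed (auto simp: distrib_left intro: lin_span.intros l)
  have R1: "p * single m 1 \<in> lin_span G" if "p \<in> lin_span G" for p m
    using that
    by induction (auto simp: distrib_right mult.assoc intro: lin_span.intros r)
  have e: "single m c = single 0 c * single m (1::'k)" for m :: 'm and c
    by (simp add: mult_single)
  have L: "q * p \<in> lin_span G" if "p \<in> lin_span G" for p q
  proof (induction q rule: pm_induct)
    case (add q m c)
    have "single m c * p = single 0 c * (single m 1 * p)"
      using e[of m c] by (simp only: mult.assoc)
    then show ?case using add by (auto simp: distrib_right intro!: lin_span.add lin_span.scale L1[OF that])
  qed (auto intro: lin_span.zero)
  have R: "p * q \<in> lin_span G" if "p \<in> lin_span G" for p q
  proof (induction q rule: pm_induct)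
    case (add q m c)
    have "p * single m c = single 0 c * (p * single m 1)"
      using e[of m c] sc by (metis mult.assoc)
    then show ?case using add by (auto simp: distrib_left intro!: lin_span.add lin_span.scale R1[OF that])
  qed (auto intro: lin_span.zero)
  show ?thesis unfolding is_ideal_def by (auto intro: L R lin_span.zero lin_span.add)
qed


section \<open>The algebra \<open>H\<^sub>8\<close>\<close>

text \<open>The free algebra \<open>k\<langle>x,y,z\<rangle>\<close> is the monoid algebra of the words in three letters.\<close>

datatype gen = X | Y | Z

instantiation list :: (type) monoid_add
begin

definition zero_list :: "'a list" where "zero_list = []"
definition plus_list :: "'a list \<Rightarrow> 'a list \<Rightarrow> 'a list" where "plus_list xs ys = xs @ ys"

instance by standard (simp_all add: zero_list_def plus_list_def)

end

definition letter :: "gen \<Rightarrow> (gen list \<Rightarrow>\<^sub>0 'k::ring_1)" where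
  "letter g = single [g] 1"

definition H8_relations :: "(gen list \<Rightarrow>\<^sub>0 'k::field) set" where
  "H8_relations =
    (let x = letter X; y = letter Y; z = letter Z in
      {x^2 - 1,
       y^2 - 1,
       x * y - y * x,
       z * x - y * z,
       z * y - x * z,
       z^2 - single 0 (1/2) * (1 + x + y - x * y)})"

quotient_type (overloaded) 'k H8 =
    "gen list \<Rightarrow>\<^sub>0 'k::field_char_ne_2" / "\<lambda>p q. p - q \<in> two_sided_ideal H8_relations"
  by (rule ideal_equivp[OF two_sided_ideal_is_ideal])

lemma prod_list_map_hom: "prod_list (map f (m + n)) = prod_list (map f m) * prod_list (map f n)"
  for f :: "gen \<Rightarrow> 'a::monoid_mult"
  by (simp add: plus_list_def)

lemma prod_list_map_anti:
  "prod_list (map f (rev (m + n))) = prod_list (map f (rev n)) * prod_list (map f (rev m))"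
  for f :: "gen \<Rightarrow> 'a::monoid_mult"
  by (simp add: plus_list_def)

abbreviation (input) word_counit :: "gen list \<Rightarrow> 'k::monoid_mult" where
  "word_counit w \<equiv> prod_list (map (\<lambda>_. 1) w)"

lemma word_one: "prod_list (map f 0) = (1::'a::monoid_mult)"
  by (simp add: zero_list_def)

lemma counit_relations:
  assumes "g \<in> H8_relations"
  shows "lin_ext (\<lambda>c::'k::field_char_ne_2. c) word_counit g = 0"
proof -
  have "word_counit (m + n) = word_counit m * (word_counit n :: 'k)" for m n :: "gen list"
    by (rule prod_list_map_hom)
  note M = field_scalars.ext_mult[where f = "word_counit", OF this]
  have 1: "lin_ext (\<lambda>c::'k. c) word_counit (1 :: gen list \<Rightarrow>\<^sub>0 'k) = 1"
    by (simp del: single_one add: single_one[symmetric] word_one)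
  show ?thesis
    using assms two_ne_0[where 'a = 'k]
    by (auto simp: H8_relations_def Let_def letter_def power2_eq_square M 1 word_one
        field_scalars.ext_add field_scalars.ext_diff)
qed

lemma counit_ideal:
  "p \<in> two_sided_ideal H8_relations \<Longrightarrow> lin_ext (\<lambda>c::'k::field_char_ne_2. c) word_counit p = 0"
  by (rule field_scalars.ext_ideal[where f = "word_counit", OF prod_list_map_hom counit_relations])

instantiation H8 :: (field_char_ne_2) ring_1
begin

lift_definition zero_H8 :: "'a H8" is 0 .
lift_definition one_H8 :: "'a H8" is 1 .
lift_definition plus_H8 :: "'a H8 \<Rightarrow> 'a H8 \<Rightarrow> 'a H8" is "(+)"
  by (rule ideal_cong_add[OF two_sided_ideal_is_ideal])
lift_definition uminus_H8 :: "'a H8 \<Rightarrow> 'a H8" is "uminus"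
  by (rule ideal_cong_minus[OF two_sided_ideal_is_ideal])
lift_definition minus_H8 :: "'a H8 \<Rightarrow> 'a H8 \<Rightarrow> 'a H8" is "(-)"
  by (rule ideal_cong_diff[OF two_sided_ideal_is_ideal])
lift_definition times_H8 :: "'a H8 \<Rightarrow> 'a H8 \<Rightarrow> 'a H8" is "(*)"
  by (rule ideal_cong_mult[OF two_sided_ideal_is_ideal])

instance
proof
  show "(0::'a H8) \<noteq> 1"
  proof (transfer, rule notI)
    assume "(0 - 1 :: gen list \<Rightarrow>\<^sub>0 'a) \<in> two_sided_ideal H8_relations"
    from counit_ideal[OF this] show False
      by (simp del: single_one add: single_one[symmetric] word_one field_scalars.ext_minus)
  qed
qed (transfer; simp add: algebra_simps two_sided_ideal.zero)+

end

lift_definition scalar_H8 :: "'k::field_char_ne_2 \<Rightarrow> 'k H8" is "single 0" .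

lift_definition gen_H8 :: "gen \<Rightarrow> 'k::field_char_ne_2 H8" is letter .

abbreviation x\<^sub>8 :: "'k::field_char_ne_2 H8" where "x\<^sub>8 \<equiv> gen_H8 X"
abbreviation y\<^sub>8 :: "'k::field_char_ne_2 H8" where "y\<^sub>8 \<equiv> gen_H8 Y"
abbreviation z\<^sub>8 :: "'k::field_char_ne_2 H8" where "z\<^sub>8 \<equiv> gen_H8 Z"

lemma single_0_central: "single 0 c * p = p * single 0 (c::'k::field)"
  by (induction p rule: pm_induct) (simp_all add: algebra_simps mult_single)

interpretation H8: scalar_map "scalar_H8 :: 'k::field_char_ne_2 \<Rightarrow> 'k H8"
  by unfold_locales
    (transfer; simp add: single_add mult_single single_0_central two_sided_ideal.zero)+

lemma rel_imp_eq:
  assumes "p - q \<in> H8_relations" shows "abs_H8 p = abs_H8 q"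
  using assms by (simp add: H8.abs_eq_iff two_sided_ideal.gen)

lemma H8_rels:
  shows H8_xx: "x\<^sub>8 * x\<^sub>8 = (1 :: 'k::field_char_ne_2 H8)"
    and H8_yy: "y\<^sub>8 * y\<^sub>8 = (1 :: 'k H8)"
    and H8_xy: "x\<^sub>8 * y\<^sub>8 = (y\<^sub>8 * x\<^sub>8 :: 'k H8)"
    and H8_zx: "z\<^sub>8 * x\<^sub>8 = (y\<^sub>8 * z\<^sub>8 :: 'k H8)"
    and H8_zy: "z\<^sub>8 * y\<^sub>8 = (x\<^sub>8 * z\<^sub>8 :: 'k H8)"
    and H8_zz: "z\<^sub>8 * z\<^sub>8 = scalar_H8 (1/2) * (1 + x\<^sub>8 + y\<^sub>8 - x\<^sub>8 * y\<^sub>8 :: 'k H8)"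
  by (transfer, rule two_sided_ideal.gen, simp add: H8_relations_def Let_def power2_eq_square)+

lift_definition counit :: "'k::field_char_ne_2 H8 \<Rightarrow> 'k" is "lin_ext (\<lambda>c. c) word_counit"
  using counit_ideal by (metis eq_iff_diff_eq_0 field_scalars.ext_diff)

lemma counit_add: "counit (a + b) = counit a + counit b"
  by transfer (rule field_scalars.ext_add)
lemma counit_mult: "counit (a * b) = counit a * counit b"
  by transfer (rule field_scalars.ext_mult[OF prod_list_map_hom])
lemma counit_scalar: "counit (scalar_H8 c) = c"
  by transfer (simp add: word_one)
lemma counit_one: "counit 1 = 1"
  using counit_scalar[of 1] by (simp add: H8.\<iota>_one)

lemma antipode_relations:
  assumes "g \<in> H8_relations"
  shows "lin_ext (scalar_H8 :: 'k::field_char_ne_2 \<Rightarrow> _) (\<lambda>w. prod_list (map gen_H8 (rev w))) g = 0"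
proof -
  note M = H8.ext_anti[where f = "\<lambda>w. prod_list (map gen_H8 (rev w))", OF prod_list_map_anti]
  have 1: "lin_ext (scalar_H8 :: 'k \<Rightarrow> _) (\<lambda>w. prod_list (map gen_H8 (rev w))) 1 = 1"
    by (simp del: single_one add: single_one[symmetric] zero_list_def H8.\<iota>_one)
  show ?thesis
    using assms
    by (auto simp: H8_relations_def Let_def letter_def power2_eq_square M 1 H8.\<iota>_one zero_list_def
        H8.ext_add H8.ext_diff H8_rels H8.\<iota>_central)
qed

lift_definition antipode :: "'k::field_char_ne_2 H8 \<Rightarrow> 'k H8"
  is "lin_ext scalar_H8 (\<lambda>w. prod_list (map gen_H8 (rev w)))"
  using H8.ext_ideal_anti[where f = "\<lambda>w. prod_list (map gen_H8 (rev w))", OF prod_list_map_anti antipode_relations]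
  by (metis eq_iff_diff_eq_0 H8.ext_diff)


section \<open>Tensor powers of \<open>H\<^sub>8\<close>\<close>

text \<open>\<open>H \<otimes> H\<close> is the free vector space on \<open>H \<times> H\<close> modulo the span of the
  bilinearity relations, and similarly for \<open>H \<otimes> H \<otimes> H\<close>. Since that free vector space is the
  monoid algebra of the multiplicative monoid \<open>H \<times> H\<close>, the quotient inherits the product
  \<open>(a \<otimes> b)(c \<otimes> d) = ac \<otimes> bd\<close>. The type \<open>'m adt\<close> is the copy of a multiplicative
  monoid in additive notation.\<close>

instantiation prod :: (monoid_mult, monoid_mult) monoid_mult
begin

definition one_prod :: "'a \<times> 'b" where "one_prod = (1, 1)"
definition times_prod :: "'a \<times> 'b \<Rightarrow> 'a \<times> 'b \<Rightarrow> 'a \<times> 'b" where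
  "times_prod p q = (fst p * fst q, snd p * snd q)"

instance by standard (simp_all add: one_prod_def times_prod_def mult.assoc)

end

datatype 'm adt = Adt 'm

instantiation adt :: (monoid_mult) monoid_add
begin

definition zero_adt :: "'a adt" where "zero_adt = Adt 1"
fun plus_adt :: "'a adt \<Rightarrow> 'a adt \<Rightarrow> 'a adt" where "Adt a + Adt b = Adt (a * b)"

instance
proof
  fix a b c :: "'a adt"
  show "a + b + c = a + (b + c)" by (cases a; cases b; cases c) (simp add: mult.assoc)
  show "0 + a = a" "a + 0 = a" by (cases a; simp add: zero_adt_def)+
qed

end

text \<open>\<open>F\<close> is a set of maps that are to become linear.\<close>

definition linearity_relations ::
  "('k::field_char_ne_2 H8 \<Rightarrow> ('m::monoid_add \<Rightarrow>\<^sub>0 'k)) set \<Rightarrow> ('m \<Rightarrow>\<^sub>0 'k) set" where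
  "linearity_relations F =
    {f (a + b) - f a - f b | f a b. f \<in> F} \<union>
    {f (scalar_H8 c * a) - single 0 c * f a | f c a. f \<in> F}"

lemma linearity_relationsI:
  assumes "f \<in> F"
  shows "f (a + b) - f a - f b \<in> linearity_relations F"
    and "f (scalar_H8 c * a) - single 0 c * f a \<in> linearity_relations F"
  using assms unfolding linearity_relations_def by blast+

lemma linearity_span_ideal:
  assumes l: "\<And>f m. f \<in> F \<Longrightarrow> \<exists>g\<in>F. \<exists>u. \<forall>a. single m 1 * f a = g (u * a)"
    and r: "\<And>f m. f \<in> F \<Longrightarrow> \<exists>g\<in>F. \<exists>u. \<forall>a. f a * single m 1 = g (a * u)"
  shows "is_ideal (lin_span (linearity_relations F))"
proof (rule span_is_ideal)
  fix e m assume e: "e \<in> linearity_relations F"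
  show "single m 1 * e \<in> lin_span (linearity_relations F)"
  proof -
    from e consider f a b where "f \<in> F" "e = f (a + b) - f a - f b"
      | f c a where "f \<in> F" "e = f (scalar_H8 c * a) - single 0 c * f a"
      by (auto simp: linearity_relations_def)
    then show ?thesis
    proof cases
      case 1
      with l obtain g u where g: "g \<in> F" "\<And>a. single m 1 * f a = g (u * a)" by metis
      have "single m 1 * e = g (u * a + u * b) - g (u * a) - g (u * b)"
        by (simp add: 1 g right_diff_distrib distrib_left)
      then show ?thesis using g(1) by (simp add: lin_span.gen linearity_relationsI)
    next
      case 2
      with l obtain g u where g: "g \<in> F" "\<And>a. single m 1 * f a = g (u * a)" by metis
      have "single m 1 * (single 0 c * f a) = single 0 c * (single m 1 * f a)"
        by (metis mult.assoc single_0_central)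
      moreover have "u * (scalar_H8 c * a) = scalar_H8 c * (u * a)"
        by (metis mult.assoc H8.\<iota>_central)
      ultimately have "single m 1 * e = g (scalar_H8 c * (u * a)) - single 0 c * g (u * a)"
        by (simp add: 2 g right_diff_distrib)
      then show ?thesis using g(1) by (simp add: lin_span.gen linearity_relationsI)
    qed
  qed
  show "e * single m 1 \<in> lin_span (linearity_relations F)"
  proof -
    from e consider f a b where "f \<in> F" "e = f (a + b) - f a - f b"
      | f c a where "f \<in> F" "e = f (scalar_H8 c * a) - single 0 c * f a"
      by (auto simp: linearity_relations_def)
    then show ?thesis
    proof cases
      case 1
      with r obtain g u where g: "g \<in> F" "\<And>a. f a * single m 1 = g (a * u)" by metis
      have "e * single m 1 = g (a * u + b * u) - g (a * u) - g (b * u)"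
        by (simp add: 1 g left_diff_distrib distrib_right)
      then show ?thesis using g(1) by (simp add: lin_span.gen linearity_relationsI)
    next
      case 2
      with r obtain g u where g: "g \<in> F" "\<And>a. f a * single m 1 = g (a * u)" by metis
      have "e * single m 1 = g (scalar_H8 c * (a * u)) - single 0 c * g (a * u)"
        by (simp add: 2 g left_diff_distrib mult.assoc)
      then show ?thesis using g(1) by (simp add: lin_span.gen linearity_relationsI)
    qed
  qed
qed

lemma ext_linearity:
  fixes \<iota> :: "'k::field_char_ne_2 \<Rightarrow> 'a::ring_1" and f :: "'m::monoid_add \<Rightarrow> 'a"
  assumes \<iota>: "scalar_map \<iota>"
    and "\<And>h a b. h \<in> F \<Longrightarrow> lin_ext \<iota> f (h (a + b)) = lin_ext \<iota> f (h a) + lin_ext \<iota> f (h b)"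
    and "\<And>h c a. h \<in> F \<Longrightarrow> lin_ext \<iota> f (h (scalar_H8 c * a)) = \<iota> c * lin_ext \<iota> f (h a)"
    and "p \<in> lin_span (linearity_relations F)"
  shows "lin_ext \<iota> f p = 0"
  using _ assms(4)
proof (rule scalar_map.ext_span[OF \<iota>])
  fix g assume "g \<in> linearity_relations F"
  then show "lin_ext \<iota> f g = 0"
    using assms(2,3)
    by (auto simp: linearity_relations_def scalar_map.ext_diff[OF \<iota>] scalar_map.ext_scale[OF \<iota>])
qed


subsection \<open>\<open>H\<^sub>8 \<otimes> H\<^sub>8\<close>\<close>

definition pure_2 :: "'k::field_char_ne_2 H8 \<Rightarrow> 'k H8 \<Rightarrow> (('k H8 \<times> 'k H8) adt \<Rightarrow>\<^sub>0 'k)" where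
  "pure_2 a b = single (Adt (a, b)) 1"

definition slots_2 :: "('k::field_char_ne_2 H8 \<Rightarrow> (('k H8 \<times> 'k H8) adt \<Rightarrow>\<^sub>0 'k)) set" where
  "slots_2 = range (\<lambda>b a. pure_2 a b) \<union> range (\<lambda>a b. pure_2 a b)"

lemma slots_2_ideal: "is_ideal (lin_span (linearity_relations slots_2))"
proof (rule linearity_span_ideal)
  fix f :: "'k::field_char_ne_2 H8 \<Rightarrow> (('k H8 \<times> 'k H8) adt \<Rightarrow>\<^sub>0 'k)" and m :: "('k H8 \<times> 'k H8) adt"
  assume f: "f \<in> slots_2"
  obtain s t where m: "m = Adt (s, t)" by (metis adt.exhaust surj_pair)
  from f show "\<exists>g\<in>slots_2. \<exists>u. \<forall>a. single m 1 * f a = g (u * a)"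
    and "\<exists>g\<in>slots_2. \<exists>u. \<forall>a. f a * single m 1 = g (a * u)"
    unfolding slots_2_def m by (fastforce simp: pure_2_def mult_single times_prod_def)+
qed

quotient_type (overloaded) 'k H8_2 = "('k::field_char_ne_2 H8 \<times> 'k H8) adt \<Rightarrow>\<^sub>0 'k"
  / "\<lambda>p q. p - q \<in> lin_span (linearity_relations slots_2)"
  by (rule ideal_equivp[OF slots_2_ideal])

lemma augment_2:
  assumes "p \<in> lin_span (linearity_relations slots_2)"
  shows "lin_ext (\<lambda>c::'k::field_char_ne_2. c) (\<lambda>m. case m of Adt (a, b) \<Rightarrow> counit a * counit b) p = 0"
  using field_scalars.scalar_map_axioms _ _ assms
  by (rule ext_linearity)
    (auto simp: slots_2_def pure_2_def counit_add counit_mult counit_scalar algebra_simps)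

instantiation H8_2 :: (field_char_ne_2) ring_1
begin

lift_definition zero_H8_2 :: "'a H8_2" is 0 .
lift_definition one_H8_2 :: "'a H8_2" is 1 .
lift_definition plus_H8_2 :: "'a H8_2 \<Rightarrow> 'a H8_2 \<Rightarrow> 'a H8_2" is "(+)"
  by (rule ideal_cong_add[OF slots_2_ideal])
lift_definition uminus_H8_2 :: "'a H8_2 \<Rightarrow> 'a H8_2" is "uminus"
  by (rule ideal_cong_minus[OF slots_2_ideal])
lift_definition minus_H8_2 :: "'a H8_2 \<Rightarrow> 'a H8_2 \<Rightarrow> 'a H8_2" is "(-)"
  by (rule ideal_cong_diff[OF slots_2_ideal])
lift_definition times_H8_2 :: "'a H8_2 \<Rightarrow> 'a H8_2 \<Rightarrow> 'a H8_2" is "(*)"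
  by (rule ideal_cong_mult[OF slots_2_ideal])

instance
proof
  show "(0::'a H8_2) \<noteq> 1"
  proof
    assume "(0::'a H8_2) = 1"
    then have "(0 - 1 :: ('a H8 \<times> 'a H8) adt \<Rightarrow>\<^sub>0 'a) \<in> lin_span (linearity_relations slots_2)"
      by (simp add: zero_H8_2_def one_H8_2_def H8_2.abs_eq_iff)
    from augment_2[OF this] show False
      by (simp del: single_one add: single_one[symmetric] field_scalars.ext_minus
          zero_adt_def one_prod_def counit_one)
  qed
qed (transfer; simp add: algebra_simps lin_span.zero)+

end

lift_definition scalar_2 :: "'k::field_char_ne_2 \<Rightarrow> 'k H8_2" is "single 0" .

interpretation H8_2: scalar_map "scalar_2 :: 'k::field_char_ne_2 \<Rightarrow> 'k H8_2"
  by unfold_locales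
    (transfer; simp add: single_add mult_single single_0_central lin_span.zero)+

definition tensor_2 :: "'k::field_char_ne_2 H8 \<Rightarrow> 'k H8 \<Rightarrow> 'k H8_2"  (infix "\<otimes>" 75) where
  "a \<otimes> b = abs_H8_2 (pure_2 a b)"

lemma tensor_2_mult: "(a \<otimes> b) * (c \<otimes> d) = (a * c) \<otimes> (b * d)"
  by (simp add: tensor_2_def times_H8_2.abs_eq pure_2_def mult_single times_prod_def)

lemma tensor_2_one: "1 \<otimes> 1 = (1 :: 'k::field_char_ne_2 H8_2)"
  by (simp add: tensor_2_def one_H8_2_def pure_2_def flip: zero_adt_def one_prod_def)

lemma slot_2_linear:
  assumes "f \<in> slots_2"
  shows "abs_H8_2 (f (a + b)) = abs_H8_2 (f a) + abs_H8_2 (f b)"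
    and "abs_H8_2 (f (scalar_H8 c * a)) = scalar_2 c * abs_H8_2 (f a)"
proof -
  have "f (a + b) - f a - f b \<in> linearity_relations slots_2"
    "f (scalar_H8 c * a) - single 0 c * f a \<in> linearity_relations slots_2"
    using assms by (rule linearity_relationsI)+
  from this[THEN lin_span.gen] show "abs_H8_2 (f (a + b)) = abs_H8_2 (f a) + abs_H8_2 (f b)"
    and "abs_H8_2 (f (scalar_H8 c * a)) = scalar_2 c * abs_H8_2 (f a)"
    by (simp_all add: plus_H8_2.abs_eq times_H8_2.abs_eq scalar_2.abs_eq H8_2.abs_eq_iff
        diff_diff_eq)
qed

lemma tensor_2_add_left: "(a + a') \<otimes> b = a \<otimes> b + a' \<otimes> b"
  unfolding tensor_2_def by (rule slot_2_linear(1)[of "\<lambda>a. pure_2 a b"]) (simp add: slots_2_def)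
lemma tensor_2_add_right: "a \<otimes> (b + b') = a \<otimes> b + a \<otimes> b'"
  unfolding tensor_2_def by (rule slot_2_linear(1)[of "\<lambda>b. pure_2 a b"]) (simp add: slots_2_def)
lemma tensor_2_scale_left: "(scalar_H8 c * a) \<otimes> b = scalar_2 c * (a \<otimes> b)"
  unfolding tensor_2_def by (rule slot_2_linear(2)[of "\<lambda>a. pure_2 a b"]) (simp add: slots_2_def)
lemma tensor_2_scale_right: "a \<otimes> (scalar_H8 c * b) = scalar_2 c * (a \<otimes> b)"
  unfolding tensor_2_def by (rule slot_2_linear(2)[of "\<lambda>b. pure_2 a b"]) (simp add: slots_2_def)

lemma tensor_2_diff_left: "(a - a') \<otimes> b = a \<otimes> b - a' \<otimes> b"
  using tensor_2_add_left[of "a - a'" a' b] by (simp add: algebra_simps)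
lemma tensor_2_diff_right: "a \<otimes> (b - b') = a \<otimes> b - a \<otimes> b'"
  using tensor_2_add_right[of a "b - b'" b'] by (simp add: algebra_simps)

lemma bilinear_ext_cong:
  fixes \<iota> :: "'k::field_char_ne_2 \<Rightarrow> 'a::ring_1" and f :: "'k H8 \<Rightarrow> 'k H8 \<Rightarrow> 'a"
  assumes \<iota>: "scalar_map \<iota>"
    and "\<And>a a' b. f (a + a') b = f a b + f a' b" "\<And>a b b'. f a (b + b') = f a b + f a b'"
    "\<And>c a b. f (scalar_H8 c * a) b = \<iota> c * f a b" "\<And>c a b. f a (scalar_H8 c * b) = \<iota> c * f a b"
    "p - q \<in> lin_span (linearity_relations slots_2)"
  shows "lin_ext \<iota> (\<lambda>m. case m of Adt (a, b) \<Rightarrow> f a b) p = lin_ext \<iota> (\<lambda>m. case m of Adt (a, b) \<Rightarrow> f a b) q"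
proof -
  have "lin_ext \<iota> (\<lambda>m. case m of Adt (a, b) \<Rightarrow> f a b) (p - q) = 0"
    using \<iota> _ _ assms(6)
    by (rule ext_linearity) (auto simp: slots_2_def pure_2_def scalar_map.\<iota>_one[OF \<iota>] assms(2-5)
        scalar_map.ext_single[OF \<iota>])
  then show ?thesis by (simp add: scalar_map.ext_diff[OF \<iota>])
qed

lift_definition flip :: "'k::field_char_ne_2 H8_2 \<Rightarrow> 'k H8_2"
  is "lin_ext scalar_2 (\<lambda>m. case m of Adt (a, b) \<Rightarrow> b \<otimes> a)"
  by (rule bilinear_ext_cong[OF H8_2.scalar_map_axioms])
    (simp_all add: tensor_2_add_left tensor_2_add_right tensor_2_scale_left tensor_2_scale_right)

lemma flip_tensor: "flip (a \<otimes> b) = b \<otimes> a"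
  by (simp add: tensor_2_def flip.abs_eq) (simp add: pure_2_def H8_2.\<iota>_one)


subsection \<open>The comultiplication\<close>

fun comul_gen :: "gen \<Rightarrow> 'k::field_char_ne_2 H8_2" where
  "comul_gen X = x\<^sub>8 \<otimes> x\<^sub>8"
| "comul_gen Y = y\<^sub>8 \<otimes> y\<^sub>8"
| "comul_gen Z = scalar_2 (1/2) * ((z\<^sub>8 \<otimes> z\<^sub>8) * (1 \<otimes> 1 + y\<^sub>8 \<otimes> 1 + 1 \<otimes> x\<^sub>8 - y\<^sub>8 \<otimes> x\<^sub>8))"

lemma comul_square_aux:
  fixes a b c d :: "'a::ring_1"
  assumes comm: "b * a = a * b" "c * a = a * c" "d * a = a * d" "c * b = b * c" "d * b = b * d" "d * c = c * d"
    and sq: "a * a = 1" "b * b = 1" "c * c = 1" "d * d = 1"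
  shows "(1 + a + b - a * b) * (1 + c + d - c * d) * ((1 + a + d - a * d) * (1 + b + c - b * c))
     = 8 * (1 + a * c + b * d - a * c * (b * d))"
proof -
  have lcomm: "b * (a * t) = a * (b * t)" "c * (a * t) = a * (c * t)" "d * (a * t) = a * (d * t)"
    "c * (b * t) = b * (c * t)" "d * (b * t) = b * (d * t)" "d * (c * t) = c * (d * t)" for t
    using comm by (metis mult.assoc)+
  have lsq: "a * (a * t) = t" "b * (b * t) = t" "c * (c * t) = t" "d * (d * t) = t" for t
    using sq by (metis mult.assoc mult_1)+
  have *: "2 * u * (2 * v) = 2 * (2 * (u * v))" for u v :: 'a
    by (simp add: mult_2 distrib_left distrib_right)
  note N = comm sq lcomm lsq mult.assoc distrib_left distrib_right left_diff_distrib right_diff_distrib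
  have "(1 + a + b - a * b) * (1 + a + d - a * d) = 2 * (1 + a + b * d - a * (b * d))"
    by (simp add: N mult_2 algebra_simps)
  moreover have "(1 + c + d - c * d) * (1 + b + c - b * c) = 2 * (1 + c + b * d - b * (c * d))"
    by (simp add: N mult_2 algebra_simps)
  moreover have "(1 + c + d - c * d) * (1 + a + d - a * d) = (1 + a + d - a * d) * (1 + c + d - c * d)"
    by (simp add: N algebra_simps)
  ultimately have "(1 + a + b - a * b) * (1 + c + d - c * d) * ((1 + a + d - a * d) * (1 + b + c - b * c))
      = 2 * (1 + a + b * d - a * (b * d)) * (2 * (1 + c + b * d - b * (c * d)))"
    by (metis mult.assoc)
  also have "\<dots> = 2 * (2 * ((1 + a + b * d - a * (b * d)) * (1 + c + b * d - b * (c * d))))"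
    by (rule *)
  also have "(1 + a + b * d - a * (b * d)) * (1 + c + b * d - b * (c * d)) = 2 * (1 + a * c + b * d - a * c * (b * d))"
    by (simp add: N mult_2 algebra_simps)
  also have "2 * (2 * (2 * (1 + a * c + b * d - a * c * (b * d)))) = 8 * (1 + a * c + b * d - a * c * (b * d))"
    by (simp flip: mult.assoc)
  finally show ?thesis .
qed

lemma comul_gen_rels:
  shows "comul_gen X * comul_gen X = (1 :: 'k::field_char_ne_2 H8_2)"
    and "comul_gen Y * comul_gen Y = (1 :: 'k H8_2)"
    and "comul_gen X * comul_gen Y = (comul_gen Y * comul_gen X :: 'k H8_2)"
    and "comul_gen Z * comul_gen X = (comul_gen Y * comul_gen Z :: 'k H8_2)"
    and "comul_gen Z * comul_gen Y = (comul_gen X * comul_gen Z :: 'k H8_2)"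
    and "comul_gen Z * comul_gen Z = scalar_2 (1/2) *
      (1 + comul_gen X + comul_gen Y - comul_gen X * comul_gen Y :: 'k H8_2)"
proof -
  define a b c d w where "a = x\<^sub>8 \<otimes> (1 :: 'k H8)" and "b = y\<^sub>8 \<otimes> (1 :: 'k H8)"
    and "c = (1 :: 'k H8) \<otimes> x\<^sub>8" and "d = (1 :: 'k H8) \<otimes> y\<^sub>8" and "w = z\<^sub>8 \<otimes> (z\<^sub>8 :: 'k H8)"
  note D = a_def b_def c_def d_def w_def
  define h where "h = (scalar_2 (1/2) :: 'k H8_2)"
  have h: "h * t = t * h" for t unfolding h_def by (rule H8_2.\<iota>_central)
  have h2: "h + h = 1" unfolding h_def by (simp only: H8_2.\<iota>_add[symmetric] half_double H8_2.\<iota>_one)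
  have comm: "b * a = a * b" "c * a = a * c" "d * a = a * d" "c * b = b * c" "d * b = b * d" "d * c = c * d"
    and sq: "a * a = 1" "b * b = 1" "c * c = 1" "d * d = 1"
    by (simp_all add: D tensor_2_mult H8_rels tensor_2_one)
  have wm: "w * a = b * w" "w * b = a * w" "w * c = d * w" "w * d = c * w"
    by (simp_all add: D tensor_2_mult H8_rels)
  have lw: "w * (a * t) = b * (w * t)" "w * (b * t) = a * (w * t)"
    "w * (c * t) = d * (w * t)" "w * (d * t) = c * (w * t)" for t
    using wm by (metis mult.assoc)+
  have lcomm: "b * (a * t) = a * (b * t)" "c * (a * t) = a * (c * t)" "d * (a * t) = a * (d * t)"
    "c * (b * t) = b * (c * t)" "d * (b * t) = b * (d * t)" "d * (c * t) = c * (d * t)" for t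
    using comm by (metis mult.assoc)+
  have lsq: "a * (a * t) = t" "b * (b * t) = t" "c * (c * t) = t" "d * (d * t) = t" for t
    using sq by (metis mult.assoc mult_1)+
  note N = comm sq lcomm lsq wm lw mult.assoc distrib_left distrib_right left_diff_distrib right_diff_distrib
  define J where "J = 1 + b + c - b * c"
  have X: "comul_gen X = a * c" and Y: "comul_gen Y = b * d"
    by (simp_all add: D tensor_2_mult)
  have Z: "comul_gen Z = h * (w * J)"
    by (simp add: D J_def h_def tensor_2_mult tensor_2_one)
  show "comul_gen X * comul_gen X = (1 :: 'k H8_2)"
    "comul_gen Y * comul_gen Y = (1 :: 'k H8_2)"
    "comul_gen X * comul_gen Y = (comul_gen Y * comul_gen X :: 'k H8_2)"
    by (simp_all add: X Y N del: comul_gen.simps)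
  have hl: "a * (h * t) = h * (a * t)" "b * (h * t) = h * (b * t)" "c * (h * t) = h * (c * t)"
    "d * (h * t) = h * (d * t)" "w * (h * t) = h * (w * t)" "J * (h * t) = h * (J * t)" for t
    using h by (metis mult.assoc)+
  have J: "J * (a * c) = a * c * J" "J * (b * d) = b * d * J" by (simp_all add: J_def N)
  have wac: "w * (a * c * J) = b * d * (w * J)" and wbd: "w * (b * d * J) = a * c * (w * J)"
    using lw by (simp_all add: mult.assoc)
  have "comul_gen Z * comul_gen X = h * (w * (J * (a * c)))"
    by (simp add: X Z mult.assoc del: comul_gen.simps)
  also have "\<dots> = b * d * (h * (w * J))" by (simp only: J wac) (simp add: hl mult.assoc)
  finally show "comul_gen Z * comul_gen X = (comul_gen Y * comul_gen Z :: 'k H8_2)"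
    by (simp only: Y Z)
  have "comul_gen Z * comul_gen Y = h * (w * (J * (b * d)))"
    by (simp add: Y Z mult.assoc del: comul_gen.simps)
  also have "\<dots> = a * c * (h * (w * J))" by (simp only: J wbd) (simp add: hl mult.assoc)
  finally show "comul_gen Z * comul_gen Y = (comul_gen X * comul_gen Z :: 'k H8_2)"
    by (simp only: X Z)
  define P where "P = (1 + a + b - a * b) * (1 + c + d - c * d)"
  define J' where "J' = 1 + a + d - a * d"
  have ww: "w * w = h * (h * P)"
  proof -
    have "w * w = (scalar_H8 (1/2) * (1 + x\<^sub>8 + y\<^sub>8 - x\<^sub>8 * y\<^sub>8)) \<otimes>
      (scalar_H8 (1/2) * (1 + x\<^sub>8 + y\<^sub>8 - x\<^sub>8 * y\<^sub>8 :: 'k H8))"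
      by (simp add: w_def tensor_2_mult H8_zz)
    also have "\<dots> = h * (h * ((1 + x\<^sub>8 + y\<^sub>8 - x\<^sub>8 * y\<^sub>8) \<otimes> (1 + x\<^sub>8 + y\<^sub>8 - x\<^sub>8 * y\<^sub>8)))"
      by (simp add: tensor_2_scale_left tensor_2_scale_right h_def)
    also have "(1 + x\<^sub>8 + y\<^sub>8 - x\<^sub>8 * y\<^sub>8) \<otimes> (1 + x\<^sub>8 + y\<^sub>8 - x\<^sub>8 * y\<^sub>8 :: 'k H8)
      = ((1 + x\<^sub>8 + y\<^sub>8 - x\<^sub>8 * y\<^sub>8) \<otimes> 1) * (1 \<otimes> (1 + x\<^sub>8 + y\<^sub>8 - x\<^sub>8 * y\<^sub>8))"
      by (simp add: tensor_2_mult)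
    also have "\<dots> = P"
    proof -
      have "(x\<^sub>8 * y\<^sub>8) \<otimes> 1 = a * b" "1 \<otimes> (x\<^sub>8 * y\<^sub>8) = c * d"
        by (simp_all add: D tensor_2_mult)
      then show ?thesis
        by (simp add: P_def tensor_2_add_left tensor_2_add_right tensor_2_diff_left
            tensor_2_diff_right tensor_2_one flip: D)
    qed
    finally show ?thesis .
  qed
  have Jw: "J * w = w * J'" by (simp add: J_def J'_def N)
  have "comul_gen Z * comul_gen Z = h * (h * (w * (J * w * J)))"
    by (simp add: Z hl mult.assoc del: comul_gen.simps)
  also have "\<dots> = h * (h * (w * w * (J' * J)))" by (simp add: Jw mult.assoc)
  also have "\<dots> = h * (h * (h * (h * (P * (J' * J)))))" by (simp add: ww mult.assoc)
  also have "P * (J' * J) = 8 * (1 + a * c + b * d - a * c * (b * d))"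
    unfolding P_def J_def J'_def by (rule comul_square_aux[OF comm sq])
  also have "h * (h * (h * (h * (8 * (1 + a * c + b * d - a * c * (b * d)))))) =
      h * (1 + a * c + b * d - a * c * (b * d))"
  proof -
    have "h * 2 = 1" using h2 by (simp add: mult_2_right)
    then have e: "h * (2 * t) = t" for t by (metis mult.assoc mult_1)
    have "8 * t = 2 * (2 * (2 * t))" for t :: "'k H8_2" by (simp flip: mult.assoc)
    then show ?thesis by (simp only: e)
  qed
  finally show "comul_gen Z * comul_gen Z = scalar_2 (1/2) *
      (1 + comul_gen X + comul_gen Y - comul_gen X * comul_gen Y :: 'k H8_2)"
    by (simp only: X Y h_def)
qed

lemma comul_relations:
  assumes "g \<in> H8_relations"
  shows "lin_ext (scalar_2 :: 'k::field_char_ne_2 \<Rightarrow> _) (\<lambda>w. prod_list (map comul_gen w)) g = 0"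
proof -
  note M = H8_2.ext_mult[where f = "\<lambda>w. prod_list (map comul_gen w)", OF prod_list_map_hom]
  have 1: "lin_ext (scalar_2 :: 'k \<Rightarrow> _) (\<lambda>w. prod_list (map comul_gen w)) 1 = 1"
    by (simp del: single_one add: single_one[symmetric] zero_list_def H8_2.\<iota>_one)
  show ?thesis
    using assms
    by (auto simp: H8_relations_def Let_def letter_def power2_eq_square M 1 H8_2.\<iota>_one zero_list_def
        H8_2.ext_add H8_2.ext_diff comul_gen_rels simp del: comul_gen.simps)
qed

lift_definition comul :: "'k::field_char_ne_2 H8 \<Rightarrow> 'k H8_2"
  is "lin_ext scalar_2 (\<lambda>w. prod_list (map comul_gen w))"
  using H8_2.ext_ideal[where f = "\<lambda>w. prod_list (map comul_gen w)", OF prod_list_map_hom comul_relations]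
  by (metis eq_iff_diff_eq_0 H8_2.ext_diff)

lemma comul_add: "comul (a + b) = comul a + comul b"
  by transfer (rule H8_2.ext_add)
lemma comul_mult: "comul (a * b) = comul a * comul b"
  by transfer (rule H8_2.ext_mult[OF prod_list_map_hom])
lemma comul_scalar: "comul (scalar_H8 c) = scalar_2 c"
  by transfer (simp add: word_one)
lemma comul_gen: "comul (gen_H8 g) = comul_gen g"
  by transfer (simp add: letter_def H8_2.\<iota>_one)


subsection \<open>\<open>H\<^sub>8 \<otimes> H\<^sub>8 \<otimes> H\<^sub>8\<close>\<close>

definition pure_3 :: "'k::field_char_ne_2 H8 \<Rightarrow> 'k H8 \<Rightarrow> 'k H8 \<Rightarrow> (('k H8 \<times> 'k H8 \<times> 'k H8) adt \<Rightarrow>\<^sub>0 'k)" where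
  "pure_3 a b c = single (Adt (a, b, c)) 1"

definition slots_3 :: "('k::field_char_ne_2 H8 \<Rightarrow> (('k H8 \<times> 'k H8 \<times> 'k H8) adt \<Rightarrow>\<^sub>0 'k)) set" where
  "slots_3 = {\<lambda>a. pure_3 a b c | b c. True} \<union> {\<lambda>b. pure_3 a b c | a c. True} \<union> {\<lambda>c. pure_3 a b c | a b. True}"

lemma slots_3_ideal: "is_ideal (lin_span (linearity_relations slots_3))"
proof (rule linearity_span_ideal)
  fix f :: "'k::field_char_ne_2 H8 \<Rightarrow> (('k H8 \<times> 'k H8 \<times> 'k H8) adt \<Rightarrow>\<^sub>0 'k)" and m :: "('k H8 \<times> 'k H8 \<times> 'k H8) adt"
  assume f: "f \<in> slots_3"
  obtain s t u where m: "m = Adt (s, t, u)" by (metis adt.exhaust surj_pair)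
  from f consider b c where "f = (\<lambda>a. pure_3 a b c)" | a c where "f = (\<lambda>b. pure_3 a b c)"
    | a b where "f = (\<lambda>c. pure_3 a b c)" unfolding slots_3_def by blast
  then show "\<exists>g\<in>slots_3. \<exists>u. \<forall>a. single m 1 * f a = g (u * a)"
  proof cases
    case (1 b c)
    then show ?thesis by (intro bexI[of _ "\<lambda>a. pure_3 a (t * b) (u * c)"] exI[of _ s])
      (auto simp: pure_3_def mult_single times_prod_def m slots_3_def)
  next
    case (2 a c)
    then show ?thesis by (intro bexI[of _ "\<lambda>b. pure_3 (s * a) b (u * c)"] exI[of _ t])
      (auto simp: pure_3_def mult_single times_prod_def m slots_3_def)
  next
    case (3 a b)
    then show ?thesis by (intro bexI[of _ "\<lambda>c. pure_3 (s * a) (t * b) c"] exI[of _ u])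
      (auto simp: pure_3_def mult_single times_prod_def m slots_3_def)
  qed
  from f consider b c where "f = (\<lambda>a. pure_3 a b c)" | a c where "f = (\<lambda>b. pure_3 a b c)"
    | a b where "f = (\<lambda>c. pure_3 a b c)" unfolding slots_3_def by blast
  then show "\<exists>g\<in>slots_3. \<exists>u. \<forall>a. f a * single m 1 = g (a * u)"
  proof cases
    case (1 b c)
    then show ?thesis by (intro bexI[of _ "\<lambda>a. pure_3 a (b * t) (c * u)"] exI[of _ s])
      (auto simp: pure_3_def mult_single times_prod_def m slots_3_def)
  next
    case (2 a c)
    then show ?thesis by (intro bexI[of _ "\<lambda>b. pure_3 (a * s) b (c * u)"] exI[of _ t])
      (auto simp: pure_3_def mult_single times_prod_def m slots_3_def)
  next
    case (3 a b)
    then show ?thesis by (intro bexI[of _ "\<lambda>c. pure_3 (a * s) (b * t) c"] exI[of _ u])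
      (auto simp: pure_3_def mult_single times_prod_def m slots_3_def)
  qed
qed

quotient_type (overloaded) 'k H8_3 = "('k::field_char_ne_2 H8 \<times> 'k H8 \<times> 'k H8) adt \<Rightarrow>\<^sub>0 'k"
  / "\<lambda>p q. p - q \<in> lin_span (linearity_relations slots_3)"
  by (rule ideal_equivp[OF slots_3_ideal])

lemma augment_3:
  assumes "p \<in> lin_span (linearity_relations slots_3)"
  shows "lin_ext (\<lambda>c::'k::field_char_ne_2. c)
    (\<lambda>m. case m of Adt (a, b, c) \<Rightarrow> counit a * counit b * counit c) p = 0"
  using field_scalars.scalar_map_axioms _ _ assms
  by (rule ext_linearity)
    (auto simp: slots_3_def pure_3_def counit_add counit_mult counit_scalar algebra_simps)

instantiation H8_3 :: (field_char_ne_2) ring_1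
begin

lift_definition zero_H8_3 :: "'a H8_3" is 0 .
lift_definition one_H8_3 :: "'a H8_3" is 1 .
lift_definition plus_H8_3 :: "'a H8_3 \<Rightarrow> 'a H8_3 \<Rightarrow> 'a H8_3" is "(+)"
  by (rule ideal_cong_add[OF slots_3_ideal])
lift_definition uminus_H8_3 :: "'a H8_3 \<Rightarrow> 'a H8_3" is "uminus"
  by (rule ideal_cong_minus[OF slots_3_ideal])
lift_definition minus_H8_3 :: "'a H8_3 \<Rightarrow> 'a H8_3 \<Rightarrow> 'a H8_3" is "(-)"
  by (rule ideal_cong_diff[OF slots_3_ideal])
lift_definition times_H8_3 :: "'a H8_3 \<Rightarrow> 'a H8_3 \<Rightarrow> 'a H8_3" is "(*)"
  by (rule ideal_cong_mult[OF slots_3_ideal])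

instance
proof
  show "(0::'a H8_3) \<noteq> 1"
  proof
    assume "(0::'a H8_3) = 1"
    then have "(0 - 1 :: ('a H8 \<times> 'a H8 \<times> 'a H8) adt \<Rightarrow>\<^sub>0 'a) \<in> lin_span (linearity_relations slots_3)"
      by (simp add: zero_H8_3_def one_H8_3_def H8_3.abs_eq_iff)
    from augment_3[OF this] show False
      by (simp del: single_one add: single_one[symmetric] field_scalars.ext_minus
          zero_adt_def one_prod_def counit_one)
  qed
qed (transfer; simp add: algebra_simps lin_span.zero)+

end

lift_definition scalar_3 :: "'k::field_char_ne_2 \<Rightarrow> 'k H8_3" is "single 0" .

interpretation H8_3: scalar_map "scalar_3 :: 'k::field_char_ne_2 \<Rightarrow> 'k H8_3"
  by unfold_locales
    (transfer; simp add: single_add mult_single single_0_central lin_span.zero)+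

definition tensor_3 :: "'k::field_char_ne_2 H8 \<Rightarrow> 'k H8 \<Rightarrow> 'k H8 \<Rightarrow> 'k H8_3" where
  "tensor_3 a b c = abs_H8_3 (pure_3 a b c)"

lemma tensor_3_mult: "tensor_3 a b c * tensor_3 a' b' c' = tensor_3 (a * a') (b * b') (c * c')"
  by (simp add: tensor_3_def times_H8_3.abs_eq pure_3_def mult_single times_prod_def)

lemma tensor_3_one: "tensor_3 1 1 1 = (1 :: 'k::field_char_ne_2 H8_3)"
  by (simp add: tensor_3_def one_H8_3_def pure_3_def flip: zero_adt_def one_prod_def)

lemma slot_3_linear:
  assumes "f \<in> slots_3"
  shows "abs_H8_3 (f (a + b)) = abs_H8_3 (f a) + abs_H8_3 (f b)"
    and "abs_H8_3 (f (scalar_H8 c * a)) = scalar_3 c * abs_H8_3 (f a)"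
proof -
  have "f (a + b) - f a - f b \<in> linearity_relations slots_3"
    "f (scalar_H8 c * a) - single 0 c * f a \<in> linearity_relations slots_3"
    using assms by (rule linearity_relationsI)+
  from this[THEN lin_span.gen] show "abs_H8_3 (f (a + b)) = abs_H8_3 (f a) + abs_H8_3 (f b)"
    and "abs_H8_3 (f (scalar_H8 c * a)) = scalar_3 c * abs_H8_3 (f a)"
    by (simp_all add: plus_H8_3.abs_eq times_H8_3.abs_eq scalar_3.abs_eq H8_3.abs_eq_iff
        diff_diff_eq)
qed

lemma tensor_3_linear:
  shows "tensor_3 (a + a') b c = tensor_3 a b c + tensor_3 a' b c"
    and "tensor_3 a (b + b') c = tensor_3 a b c + tensor_3 a b' c"
    and "tensor_3 a b (c + c') = tensor_3 a b c + tensor_3 a b c'"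
    and "tensor_3 (scalar_H8 k * a) b c = scalar_3 k * tensor_3 a b c"
    and "tensor_3 a (scalar_H8 k * b) c = scalar_3 k * tensor_3 a b c"
    and "tensor_3 a b (scalar_H8 k * c) = scalar_3 k * tensor_3 a b c"
proof -
  have "(\<lambda>a. pure_3 a b c) \<in> slots_3" "(\<lambda>b. pure_3 a b c) \<in> slots_3" "(\<lambda>c. pure_3 a b c) \<in> slots_3"
    by (auto simp: slots_3_def)
  note S = this[THEN slot_3_linear(1)] this[THEN slot_3_linear(2)]
  show "tensor_3 (a + a') b c = tensor_3 a b c + tensor_3 a' b c"
    "tensor_3 a (b + b') c = tensor_3 a b c + tensor_3 a b' c"
    "tensor_3 a b (c + c') = tensor_3 a b c + tensor_3 a b c'"
    "tensor_3 (scalar_H8 k * a) b c = scalar_3 k * tensor_3 a b c"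
    "tensor_3 a (scalar_H8 k * b) c = scalar_3 k * tensor_3 a b c"
    "tensor_3 a b (scalar_H8 k * c) = scalar_3 k * tensor_3 a b c"
    by (simp_all only: S tensor_3_def)
qed

lift_definition leg_12 :: "'k::field_char_ne_2 H8_2 \<Rightarrow> 'k H8_3"
  is "lin_ext scalar_3 (\<lambda>m. case m of Adt (a, b) \<Rightarrow> tensor_3 a b 1)"
  by (rule bilinear_ext_cong[OF H8_3.scalar_map_axioms]) (simp_all add: tensor_3_linear)

lift_definition leg_13 :: "'k::field_char_ne_2 H8_2 \<Rightarrow> 'k H8_3"
  is "lin_ext scalar_3 (\<lambda>m. case m of Adt (a, b) \<Rightarrow> tensor_3 a 1 b)"
  by (rule bilinear_ext_cong[OF H8_3.scalar_map_axioms]) (simp_all add: tensor_3_linear)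

lift_definition leg_23 :: "'k::field_char_ne_2 H8_2 \<Rightarrow> 'k H8_3"
  is "lin_ext scalar_3 (\<lambda>m. case m of Adt (a, b) \<Rightarrow> tensor_3 1 a b)"
  by (rule bilinear_ext_cong[OF H8_3.scalar_map_axioms]) (simp_all add: tensor_3_linear)

text \<open>\<open>tensor_1_2 a (b \<otimes> c)\<close> and \<open>tensor_2_1 (a \<otimes> b) c\<close> both stand for \<open>a \<otimes> b \<otimes> c\<close>.\<close>

lift_definition tensor_1_2 :: "'k::field_char_ne_2 H8 \<Rightarrow> 'k H8_2 \<Rightarrow> 'k H8_3"
  is "\<lambda>a. lin_ext scalar_3 (\<lambda>m. case m of Adt (b, c) \<Rightarrow> tensor_3 a b c)"
  by (rule bilinear_ext_cong[OF H8_3.scalar_map_axioms]) (simp_all add: tensor_3_linear)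

lift_definition tensor_2_1 :: "'k::field_char_ne_2 H8_2 \<Rightarrow> 'k H8 \<Rightarrow> 'k H8_3"
  is "\<lambda>p c. lin_ext scalar_3 (\<lambda>m. case m of Adt (a, b) \<Rightarrow> tensor_3 a b c) p"
  by (rule ext, rule bilinear_ext_cong[OF H8_3.scalar_map_axioms]) (simp_all add: tensor_3_linear)

lemma H8_2_abs_cases: obtains p where "T = abs_H8_2 p"
  using H8_2.abs_induct[of "\<lambda>T. \<exists>p. T = abs_H8_2 p" T] by blast

lemma tensor_1_2_linear:
  shows "tensor_1_2 (a + a') T = tensor_1_2 a T + tensor_1_2 a' T"
    and "tensor_1_2 a (T + T') = tensor_1_2 a T + tensor_1_2 a T'"
    and "tensor_1_2 (scalar_H8 c * a) T = scalar_3 c * tensor_1_2 a T"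
    and "tensor_1_2 a (scalar_2 c * T) = scalar_3 c * tensor_1_2 a T"
proof -
  obtain p where p: "T = abs_H8_2 p" by (rule H8_2_abs_cases)
  obtain p' where p': "T' = abs_H8_2 p'" by (rule H8_2_abs_cases)
  show "tensor_1_2 (a + a') T = tensor_1_2 a T + tensor_1_2 a' T"
    unfolding p tensor_1_2.abs_eq H8_3.ext_fun_add[symmetric]
    by (rule arg_cong[where f = "\<lambda>f. lin_ext scalar_3 f p"]) (simp add: fun_eq_iff tensor_3_linear split: adt.split)
  show "tensor_1_2 (scalar_H8 c * a) T = scalar_3 c * tensor_1_2 a T"
    unfolding p tensor_1_2.abs_eq H8_3.ext_fun_scale[symmetric]
    by (rule arg_cong[where f = "\<lambda>f. lin_ext scalar_3 f p"]) (simp add: fun_eq_iff tensor_3_linear split: adt.split)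
  show "tensor_1_2 a (T + T') = tensor_1_2 a T + tensor_1_2 a T'"
    unfolding p p' plus_H8_2.abs_eq tensor_1_2.abs_eq by (rule H8_3.ext_add)
  show "tensor_1_2 a (scalar_2 c * T) = scalar_3 c * tensor_1_2 a T"
    unfolding p scalar_2.abs_eq times_H8_2.abs_eq tensor_1_2.abs_eq by (rule H8_3.ext_scale)
qed

lemma tensor_2_1_linear:
  shows "tensor_2_1 T (a + a') = tensor_2_1 T a + tensor_2_1 T a'"
    and "tensor_2_1 (T + T') a = tensor_2_1 T a + tensor_2_1 T' a"
    and "tensor_2_1 T (scalar_H8 c * a) = scalar_3 c * tensor_2_1 T a"
    and "tensor_2_1 (scalar_2 c * T) a = scalar_3 c * tensor_2_1 T a"
proof -
  obtain p where p: "T = abs_H8_2 p" by (rule H8_2_abs_cases)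
  obtain p' where p': "T' = abs_H8_2 p'" by (rule H8_2_abs_cases)
  show "tensor_2_1 T (a + a') = tensor_2_1 T a + tensor_2_1 T a'"
    unfolding p tensor_2_1.abs_eq H8_3.ext_fun_add[symmetric]
    by (rule arg_cong[where f = "\<lambda>f. lin_ext scalar_3 f p"]) (simp add: fun_eq_iff tensor_3_linear split: adt.split)
  show "tensor_2_1 T (scalar_H8 c * a) = scalar_3 c * tensor_2_1 T a"
    unfolding p tensor_2_1.abs_eq H8_3.ext_fun_scale[symmetric]
    by (rule arg_cong[where f = "\<lambda>f. lin_ext scalar_3 f p"]) (simp add: fun_eq_iff tensor_3_linear split: adt.split)
  show "tensor_2_1 (T + T') a = tensor_2_1 T a + tensor_2_1 T' a"
    unfolding p p' plus_H8_2.abs_eq tensor_2_1.abs_eq by (rule H8_3.ext_add)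
  show "tensor_2_1 (scalar_2 c * T) a = scalar_3 c * tensor_2_1 T a"
    unfolding p scalar_2.abs_eq times_H8_2.abs_eq tensor_2_1.abs_eq by (rule H8_3.ext_scale)
qed

lemma comul_scale: "comul (scalar_H8 c * a) = scalar_2 c * comul a"
  by (simp add: comul_mult comul_scalar)

lift_definition id_tensor_comul :: "'k::field_char_ne_2 H8_2 \<Rightarrow> 'k H8_3"
  is "lin_ext scalar_3 (\<lambda>m. case m of Adt (a, b) \<Rightarrow> tensor_1_2 a (comul b))"
  by (rule bilinear_ext_cong[OF H8_3.scalar_map_axioms])
    (simp_all add: tensor_1_2_linear comul_add comul_scale)

lift_definition comul_tensor_id :: "'k::field_char_ne_2 H8_2 \<Rightarrow> 'k H8_3"
  is "lin_ext scalar_3 (\<lambda>m. case m of Adt (a, b) \<Rightarrow> tensor_2_1 (comul a) b)"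
  by (rule bilinear_ext_cong[OF H8_3.scalar_map_axioms])
    (simp_all add: tensor_2_1_linear comul_add comul_scale)

lemma leg_tensor:
  shows "leg_12 (a \<otimes> b) = tensor_3 a b 1"
    and "leg_13 (a \<otimes> b) = tensor_3 a 1 b"
    and "leg_23 (a \<otimes> b) = tensor_3 1 a b"
    and "tensor_1_2 a (b \<otimes> c) = tensor_3 a b c"
    and "tensor_2_1 (a \<otimes> b) c = tensor_3 a b c"
    and "id_tensor_comul (a \<otimes> b) = tensor_1_2 a (comul b)"
    and "comul_tensor_id (a \<otimes> b) = tensor_2_1 (comul a) b"
  unfolding tensor_2_def leg_12.abs_eq leg_13.abs_eq leg_23.abs_eq tensor_1_2.abs_eq
    tensor_2_1.abs_eq id_tensor_comul.abs_eq comul_tensor_id.abs_eq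
  by (simp_all add: pure_2_def H8_3.\<iota>_one)


section \<open>Quasitriangular structures and infinitesimal \<open>R\<close>-matrices\<close>

definition is_unit_elt :: "'a::monoid_mult \<Rightarrow> bool" where
  "is_unit_elt a \<longleftrightarrow> (\<exists>b. a * b = 1 \<and> b * a = 1)"

definition unit_inv :: "'a::monoid_mult \<Rightarrow> 'a" where
  "unit_inv a = (THE b. a * b = 1 \<and> b * a = 1)"

lemma unit_inv:
  assumes "is_unit_elt a" shows "a * unit_inv a = 1" "unit_inv a * a = 1"
proof -
  from assms obtain b where b: "a * b = 1" "b * a = 1" unfolding is_unit_elt_def by blast
  have "c = b" if "a * c = 1" for c
  proof -
    have "c = (b * a) * c" by (simp add: b)
    also have "\<dots> = b" by (simp add: mult.assoc that)
    finally show ?thesis .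
  qed
  with b have "\<exists>!b. a * b = 1 \<and> b * a = 1" by blast
  from theI'[OF this] show "a * unit_inv a = 1" "unit_inv a * a = 1"
    unfolding unit_inv_def by auto
qed

definition quasitriangular_structure :: "'k::field_char_ne_2 H8_2 \<Rightarrow> bool" where
  "quasitriangular_structure R \<longleftrightarrow>
    is_unit_elt R \<and>
    (\<forall>h. flip (comul h) = R * comul h * unit_inv R) \<and>
    id_tensor_comul R = leg_13 R * leg_12 R \<and>
    comul_tensor_id R = leg_13 R * leg_23 R"

definition infinitesimal_R_matrix :: "'k::field_char_ne_2 H8_2 \<Rightarrow> 'k H8_2 \<Rightarrow> bool" where
  "infinitesimal_R_matrix R \<chi> \<longleftrightarrow>
    (\<forall>h. \<chi> * comul h = comul h * \<chi>) \<and>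
    id_tensor_comul \<chi> = leg_12 \<chi> + unit_inv (leg_12 R) * leg_13 \<chi> * leg_12 R \<and>
    comul_tensor_id \<chi> = leg_23 \<chi> + unit_inv (leg_23 R) * leg_13 \<chi> * leg_23 R"

end

theory Submission
  imports Defs
begin

text \<open>\<open>H\<^sub>8\<close> carries a Haar functional \<open>t\<close>: a trace with \<open>t(1) = 1\<close> and
  \<open>(Id \<otimes> t)\<Delta>(h) = t(h)1\<close>. Put \<open>u = (Id \<otimes> t)(\<chi>)\<close>. Applying \<open>Id \<otimes> Id \<otimes> t\<close> to the
  axiom for \<open>(Id \<otimes> \<Delta>)(\<chi>)\<close> gives \<open>u \<otimes> 1 = \<chi> + R\<^sup>-\<^sup>1 (u \<otimes> 1) R\<close>. As \<open>\<chi>\<close> commutes with the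
  image of \<open>\<Delta>\<close> and \<open>t\<close> is a trace, \<open>u\<close> is central, so \<open>R\<close> drops out and \<open>\<chi> = 0\<close>. This is
  Maschke's argument: \<open>\<chi>\<close> is a derivation on the dual of \<open>H\<^sub>8\<close>, hence inner.\<close>

section \<open>A crossed product model and the Haar functional\<close>

text \<open>\<open>Crossed a b\<close> stands for \<open>a + bz\<close>, where \<open>a\<close> and \<open>b\<close> are elements of \<open>k[\<langle>x,y\<rangle>]\<close> given by
  their values at the four characters \<open>(x,y) \<mapsto> (\<plusminus>1,\<plusminus>1)\<close>, \<open>True\<close> encoding the value \<open>-1\<close>.
  Conjugation by \<open>z\<close> swaps the two arguments, and \<open>crossed_cocycle\<close> is the value of \<open>z\<^sup>2\<close>.\<close>

datatype 'k crossed = Crossed "bool \<Rightarrow> bool \<Rightarrow> 'k" "bool \<Rightarrow> bool \<Rightarrow> 'k"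

definition crossed_cocycle :: "bool \<Rightarrow> bool \<Rightarrow> 'k::field" where
  "crossed_cocycle p q = (if p \<and> q then -1 else 1)"

instantiation crossed :: (field) ring_1
begin

definition zero_crossed :: "'a crossed" where
  "zero_crossed = Crossed (\<lambda>p q. 0) (\<lambda>p q. 0)"
definition one_crossed :: "'a crossed" where
  "one_crossed = Crossed (\<lambda>p q. 1) (\<lambda>p q. 0)"
fun plus_crossed :: "'a crossed \<Rightarrow> 'a crossed \<Rightarrow> 'a crossed" where
  "Crossed a b + Crossed c d = Crossed (\<lambda>p q. a p q + c p q) (\<lambda>p q. b p q + d p q)"
fun uminus_crossed :: "'a crossed \<Rightarrow> 'a crossed" where
  "- Crossed a b = Crossed (\<lambda>p q. - a p q) (\<lambda>p q. - b p q)"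
fun minus_crossed :: "'a crossed \<Rightarrow> 'a crossed \<Rightarrow> 'a crossed" where
  "Crossed a b - Crossed c d = Crossed (\<lambda>p q. a p q - c p q) (\<lambda>p q. b p q - d p q)"
fun times_crossed :: "'a crossed \<Rightarrow> 'a crossed \<Rightarrow> 'a crossed" where
  "Crossed a b * Crossed c d = Crossed
    (\<lambda>p q. a p q * c p q + b p q * d q p * crossed_cocycle p q)
    (\<lambda>p q. a p q * d p q + b p q * c q p)"

instance
proof
  fix r s t :: "'a crossed"
  obtain a b c d e f where [simp]: "r = Crossed a b" "s = Crossed c d" "t = Crossed e f"
    by (metis crossed.exhaust)
  show "r * s * t = r * (s * t)"
    by (simp add: fun_eq_iff algebra_simps crossed_cocycle_def)
  show "r + s + t = r + (s + t)" "r + s = s + r" "0 + r = r" "- r + r = 0" "r - s = r + - s"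
    "(r + s) * t = r * t + s * t" "r * (s + t) = r * s + r * t" "1 * r = r" "r * 1 = r"
    by (simp_all add: fun_eq_iff algebra_simps zero_crossed_def one_crossed_def)
  show "(0::'a crossed) \<noteq> 1"
    by (simp add: zero_crossed_def one_crossed_def fun_eq_iff)
qed

end

definition scalar_crossed :: "'k::field \<Rightarrow> 'k crossed" where
  "scalar_crossed c = Crossed (\<lambda>p q. c) (\<lambda>p q. 0)"

interpretation crossed: scalar_map "scalar_crossed :: 'k::field \<Rightarrow> 'k crossed"
proof
  fix c d :: 'k and a :: "'k crossed"
  show "scalar_crossed c * a = a * scalar_crossed c"
    by (cases a) (simp add: scalar_crossed_def mult.commute)
qed (simp_all add: scalar_crossed_def one_crossed_def)

fun crossed_gen :: "gen \<Rightarrow> 'k::field crossed" where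
  "crossed_gen X = Crossed (\<lambda>p q. if p then -1 else 1) (\<lambda>p q. 0)"
| "crossed_gen Y = Crossed (\<lambda>p q. if q then -1 else 1) (\<lambda>p q. 0)"
| "crossed_gen Z = Crossed (\<lambda>p q. 0) (\<lambda>p q. 1)"

lemma crossed_relations:
  assumes "g \<in> H8_relations"
  shows "lin_ext (scalar_crossed :: 'k::field_char_ne_2 \<Rightarrow> _) (\<lambda>w. prod_list (map crossed_gen w)) g = 0"
proof -
  note M = crossed.ext_mult[where f = "\<lambda>w. prod_list (map crossed_gen w)", OF prod_list_map_hom]
  have 1: "lin_ext (scalar_crossed :: 'k \<Rightarrow> _) (\<lambda>w. prod_list (map crossed_gen w)) 1 = 1"
    by (simp del: single_one add: single_one[symmetric] zero_list_def crossed.\<iota>_one)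
  show ?thesis
    using assms two_ne_0[where 'a = 'k]
    by (auto simp: H8_relations_def Let_def letter_def power2_eq_square M 1 crossed.\<iota>_one
        zero_list_def crossed.ext_add crossed.ext_diff one_crossed_def zero_crossed_def
        scalar_crossed_def crossed_cocycle_def fun_eq_iff)
qed

text \<open>\<open>H8\<close> is given only by generators and relations, so this homomorphism
  supplies the coordinates in which a functional can be defined and evaluated.\<close>

lift_definition crossed_of_H8 :: "'k::field_char_ne_2 H8 \<Rightarrow> 'k crossed"
  is "lin_ext scalar_crossed (\<lambda>w. prod_list (map crossed_gen w))"
  using crossed.ext_ideal[where f = "\<lambda>w. prod_list (map crossed_gen w)",
      OF prod_list_map_hom crossed_relations]
  by (metis eq_iff_diff_eq_0 crossed.ext_diff)

lemma crossed_of_H8_add: "crossed_of_H8 (a + b) = crossed_of_H8 a + crossed_of_H8 b"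
  by transfer (rule crossed.ext_add)
lemma crossed_of_H8_mult: "crossed_of_H8 (a * b) = crossed_of_H8 a * crossed_of_H8 b"
  by transfer (rule crossed.ext_mult[OF prod_list_map_hom])
lemma crossed_of_H8_scalar: "crossed_of_H8 (scalar_H8 c) = scalar_crossed c"
  by transfer (simp add: word_one)
lemma crossed_of_H8_gen: "crossed_of_H8 (gen_H8 g) = crossed_gen g"
  by transfer (simp add: letter_def crossed.\<iota>_one)
lemma crossed_of_H8_one: "crossed_of_H8 1 = 1"
  using crossed_of_H8_scalar[of 1] by (simp add: H8.\<iota>_one crossed.\<iota>_one)

text \<open>Away from characteristic 2, averaging over the four characters reads off the coefficient
  of 1 in k[<x,y>]. As the z-part is dropped, this is the coefficient of 1 among the monomials x^i
  y^j z^k with exponents 0 or 1.\<close>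

fun crossed_trace :: "'k::field crossed \<Rightarrow> 'k" where
  "crossed_trace (Crossed a b) = (a False False + a False True + a True False + a True True) / (2 * 2)"

lemma crossed_trace_add: "crossed_trace (r + s) = crossed_trace r + crossed_trace s"
  by (cases r; cases s) (simp add: add_divide_distrib)

lemma crossed_trace_scale: "crossed_trace (scalar_crossed c * r) = c * crossed_trace r"
  by (cases r) (simp add: scalar_crossed_def algebra_simps)

text \<open>The products of two z-parts agree after exchanging p and q in the sum, because the
  cocycle is symmetric.\<close>

lemma crossed_trace_commute: "crossed_trace (r * s) = crossed_trace (s * r)"
  by (cases r; cases s) (simp add: crossed_cocycle_def algebra_simps)

definition haar :: "'k::field_char_ne_2 H8 \<Rightarrow> 'k" where
  "haar a = crossed_trace (crossed_of_H8 a)"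

lemma haar_add: "haar (a + b) = haar a + haar b"
  by (simp add: haar_def crossed_of_H8_add crossed_trace_add)

lemma haar_scale: "haar (scalar_H8 c * a) = c * haar a"
  by (simp add: haar_def crossed_of_H8_mult crossed_of_H8_scalar crossed_trace_scale)

lemma haar_commute: "haar (a * b) = haar (b * a)"
  by (simp add: haar_def crossed_of_H8_mult crossed_trace_commute)

lemma haar_one: "haar (1 :: 'k::field_char_ne_2 H8) = 1"
proof -
  \<comment> \<open>The average over four characters divides by 4, which is where the characteristic
    enters.\<close>
  have "2 * 2 \<noteq> (0::'k)" by (simp only: mult_eq_0_iff two_ne_0 simp_thms)
  then have "4 \<noteq> (0::'k)" by simp
  then show ?thesis by (simp add: haar_def crossed_of_H8_one one_crossed_def)
qed

section \<open>Induction principles\<close>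

text \<open>Every element is a sum of scaled words. Starting each word from an arbitrary scalar
  takes care of its coefficient, so no scaling case arises.\<close>

lemma H8_induct [case_names scalar add gen]:
  assumes scalar: "\<And>c. P (scalar_H8 c)"
    and add: "\<And>a b. P a \<Longrightarrow> P b \<Longrightarrow> P (a + b)"
    and gen: "\<And>g a. P a \<Longrightarrow> P (gen_H8 g * a)"
  shows "P (h :: 'k::field_char_ne_2 H8)"
proof (induction h rule: H8.abs_induct)
  case (1 p)
  have word: "P (abs_H8 (single w c))" for w :: "gen list" and c :: 'k
  proof (induction w)
    case Nil
    then show ?case using scalar[of c] by (simp add: scalar_H8.abs_eq zero_list_def)
  next
    case (Cons g w)
    have "abs_H8 (single (g # w) c) = gen_H8 g * abs_H8 (single w c)"
      by (simp add: gen_H8.abs_eq times_H8.abs_eq letter_def mult_single plus_list_def)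
    then show ?case using gen[OF Cons] by simp
  qed
  show ?case
  proof (induction p rule: pm_induct)
    case zero
    then show ?case using scalar[of 0] by (simp add: H8.\<iota>_zero zero_H8_def)
  next
    case (add p m c)
    then show ?case using assms(2)[OF _ word] by (simp flip: plus_H8.abs_eq)
  qed
qed

text \<open>Serves to check \<open>id_haar_comul\<close>: that identity is linear but not
  multiplicative in \<open>h\<close>, so induction over generators does not reach it, whereas eight
  monomials do.\<close>

inductive_set H8_span :: "'k::field_char_ne_2 H8 set" where
  basis: "b \<in> {1, x\<^sub>8, y\<^sub>8, x\<^sub>8 * y\<^sub>8, z\<^sub>8, x\<^sub>8 * z\<^sub>8, y\<^sub>8 * z\<^sub>8, x\<^sub>8 * y\<^sub>8 * z\<^sub>8} \<Longrightarrow> b \<in> H8_span"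
| add: "a \<in> H8_span \<Longrightarrow> b \<in> H8_span \<Longrightarrow> a + b \<in> H8_span"
| scale: "a \<in> H8_span \<Longrightarrow> scalar_H8 c * a \<in> H8_span"

lemma H8_rels_assoc:
  fixes t :: "'k::field_char_ne_2 H8"
  shows "x\<^sub>8 * (x\<^sub>8 * t) = t" "y\<^sub>8 * (y\<^sub>8 * t) = t" "y\<^sub>8 * (x\<^sub>8 * t) = x\<^sub>8 * (y\<^sub>8 * t)"
    "z\<^sub>8 * (x\<^sub>8 * t) = y\<^sub>8 * (z\<^sub>8 * t)" "z\<^sub>8 * (y\<^sub>8 * t) = x\<^sub>8 * (z\<^sub>8 * t)"
  by (metis H8_rels mult.assoc mult_1)+

text \<open>As rewrite rules these bring a word to the order x, y, z; powers of z are left alone,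
  since z^2 is a sum.\<close>

lemmas H8_normal = mult.assoc H8_xx H8_yy H8_xy[symmetric] H8_zx H8_zy H8_rels_assoc

lemma H8_span_minus: "a \<in> H8_span \<Longrightarrow> - a \<in> H8_span"
  using H8_span.scale[of a "-1"] by (simp add: H8.\<iota>_minus H8.\<iota>_one)

lemma H8_span_gen_mult:
  assumes "a \<in> H8_span"
  shows "gen_H8 g * a \<in> (H8_span :: 'k::field_char_ne_2 H8 set)"
  using assms
proof induction
  case (basis b)
  let ?h = "scalar_H8 (1/2) :: 'k H8"
  have h: "u * (?h * t) = ?h * (u * t)" for u t :: "'k H8"
    by (metis H8.\<iota>_central mult.assoc)
  \<comment> \<open>The only products of a generator with a basis monomial that leave the basis are
    x^i y^j z^2. Differences are written as sums with a negated term to match the closure rules of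
    \<open>H8_span\<close>.\<close>
  have "z\<^sub>8 * z\<^sub>8 = ?h * (1 + x\<^sub>8 + y\<^sub>8 + - (x\<^sub>8 * y\<^sub>8))"
    "x\<^sub>8 * (z\<^sub>8 * z\<^sub>8) = ?h * (1 + x\<^sub>8 + x\<^sub>8 * y\<^sub>8 + - y\<^sub>8)"
    "y\<^sub>8 * (z\<^sub>8 * z\<^sub>8) = ?h * (1 + y\<^sub>8 + x\<^sub>8 * y\<^sub>8 + - x\<^sub>8)"
    "x\<^sub>8 * (y\<^sub>8 * (z\<^sub>8 * z\<^sub>8)) = ?h * (x\<^sub>8 + y\<^sub>8 + x\<^sub>8 * y\<^sub>8 + - 1)"
    by (simp_all add: H8_zz h) (simp_all add: algebra_simps H8_normal)
  moreover have "?h * (1 + x\<^sub>8 + y\<^sub>8 + - (x\<^sub>8 * y\<^sub>8)) \<in> H8_span"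
    "?h * (1 + x\<^sub>8 + x\<^sub>8 * y\<^sub>8 + - y\<^sub>8) \<in> H8_span"
    "?h * (1 + y\<^sub>8 + x\<^sub>8 * y\<^sub>8 + - x\<^sub>8) \<in> H8_span"
    "?h * (x\<^sub>8 + y\<^sub>8 + x\<^sub>8 * y\<^sub>8 + - 1) \<in> H8_span"
    by (intro H8_span.scale H8_span.add H8_span_minus; simp add: H8_span.basis)+
  ultimately have zz: "z\<^sub>8 * z\<^sub>8 \<in> (H8_span :: 'k H8 set)" "x\<^sub>8 * (z\<^sub>8 * z\<^sub>8) \<in> (H8_span :: 'k H8 set)"
    "y\<^sub>8 * (z\<^sub>8 * z\<^sub>8) \<in> (H8_span :: 'k H8 set)" "x\<^sub>8 * (y\<^sub>8 * (z\<^sub>8 * z\<^sub>8)) \<in> (H8_span :: 'k H8 set)"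
    by simp_all
  note B = H8_span.basis[unfolded mult.assoc]
  show ?case
    using basis by (cases g) (auto simp: H8_normal zz B)
next
  case (add a b)
  then show ?case by (simp add: distrib_left H8_span.add)
next
  case (scale a c)
  then show ?case by (metis H8.\<iota>_central H8_span.scale mult.assoc)
qed

lemma H8_span_UNIV: "h \<in> (H8_span :: 'k::field_char_ne_2 H8 set)"
proof (induction h rule: H8_induct)
  case (scalar c)
  then show ?case using H8_span.scale[OF H8_span.basis, of 1 c] by simp
qed (simp_all add: H8_span.add H8_span_gen_mult)

text \<open>Coefficients are absorbed into the first tensor factor, so adding pure tensors
  suffices.\<close>

lemma H8_2_induct [case_names zero add]:
  assumes zero: "P 0" and add: "\<And>T a b. P T \<Longrightarrow> P (T + a \<otimes> b)"
  shows "P (T :: 'k::field_char_ne_2 H8_2)"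
proof (induction T rule: H8_2.abs_induct)
  case (1 p)
  show ?case
  proof (induction p rule: pm_induct)
    case zero
    then show ?case using assms(1) by (simp add: zero_H8_2_def)
  next
    case (add p m c)
    obtain a b where m: "m = Adt (a, b)" by (metis adt.exhaust surj_pair)
    have "abs_H8_2 (single m c) = scalar_2 c * (a \<otimes> b)"
      by (simp add: m tensor_2_def pure_2_def scalar_2.abs_eq times_H8_2.abs_eq mult_single)
    then have "abs_H8_2 (p + single m c) = abs_H8_2 p + (scalar_H8 c * a) \<otimes> b"
      by (simp add: tensor_2_scale_left flip: plus_H8_2.abs_eq)
    then show ?case using assms(2)[OF add] by simp
  qed
qed

lemma H8_3_induct [case_names zero add]:
  assumes zero: "P 0" and add: "\<And>T a b c. P T \<Longrightarrow> P (T + tensor_3 a b c)"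
  shows "P (T :: 'k::field_char_ne_2 H8_3)"
proof (induction T rule: H8_3.abs_induct)
  case (1 p)
  show ?case
  proof (induction p rule: pm_induct)
    case zero
    then show ?case using assms(1) by (simp add: zero_H8_3_def)
  next
    case (add p m k)
    obtain a b c where m: "m = Adt (a, b, c)" by (metis adt.exhaust surj_pair)
    have "abs_H8_3 (single m k) = scalar_3 k * tensor_3 a b c"
      by (simp add: m tensor_3_def pure_3_def scalar_3.abs_eq times_H8_3.abs_eq mult_single)
    then have "abs_H8_3 (p + single m k) = abs_H8_3 p + tensor_3 (scalar_H8 k * a) b c"
      by (simp add: tensor_3_linear flip: plus_H8_3.abs_eq)
    then show ?case using assms(2)[OF add] by simp
  qed
qed

section \<open>Slicing with the Haar functional\<close>

lift_definition id_haar :: "'k::field_char_ne_2 H8_2 \<Rightarrow> 'k H8"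
  is "lin_ext scalar_H8 (\<lambda>m. case m of Adt (a, b) \<Rightarrow> scalar_H8 (haar b) * a)"
  by (rule bilinear_ext_cong[OF H8.scalar_map_axioms])
    (simp_all add: haar_add haar_scale H8.\<iota>_add H8.swap[where a = 1, simplified] algebra_simps)

lemma id_haar_add: "id_haar (S + T) = id_haar S + id_haar T"
  by transfer (rule H8.ext_add)

lemma id_haar_diff: "id_haar (S - T) = id_haar S - id_haar T"
  by transfer (rule H8.ext_diff)

lemma id_haar_zero: "id_haar 0 = 0"
  by transfer simp

lemma id_haar_scale: "id_haar (scalar_2 c * T) = scalar_H8 c * id_haar T"
  by transfer (rule H8.ext_scale)

lemma id_haar_tensor: "id_haar (a \<otimes> b) = scalar_H8 (haar b) * a"
  unfolding tensor_2_def id_haar.abs_eq by (simp add: pure_2_def H8.\<iota>_one)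

section \<open>Slicing the third leg of the triple tensor product\<close>

lemma trilinear_ext_cong:
  fixes \<iota> :: "'k::field_char_ne_2 \<Rightarrow> 'a::ring_1" and f :: "'k H8 \<Rightarrow> 'k H8 \<Rightarrow> 'k H8 \<Rightarrow> 'a"
  assumes \<iota>: "scalar_map \<iota>"
    and "\<And>a a' b c. f (a + a') b c = f a b c + f a' b c"
    "\<And>a b b' c. f a (b + b') c = f a b c + f a b' c"
    "\<And>a b c c'. f a b (c + c') = f a b c + f a b c'"
    "\<And>k a b c. f (scalar_H8 k * a) b c = \<iota> k * f a b c"
    "\<And>k a b c. f a (scalar_H8 k * b) c = \<iota> k * f a b c"
    "\<And>k a b c. f a b (scalar_H8 k * c) = \<iota> k * f a b c"
    and "p - q \<in> lin_span (linearity_relations slots_3)"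
  shows "lin_ext \<iota> (\<lambda>m. case m of Adt (a, b, c) \<Rightarrow> f a b c) p
    = lin_ext \<iota> (\<lambda>m. case m of Adt (a, b, c) \<Rightarrow> f a b c) q"
proof -
  have "lin_ext \<iota> (\<lambda>m. case m of Adt (a, b, c) \<Rightarrow> f a b c) (p - q) = 0"
    using \<iota> _ _ assms(8)
    by (rule ext_linearity) (auto simp: slots_3_def pure_3_def scalar_map.\<iota>_one[OF \<iota>] assms(2-7)
        scalar_map.ext_single[OF \<iota>])
  then show ?thesis by (simp add: scalar_map.ext_diff[OF \<iota>])
qed

lift_definition id_id_haar :: "'k::field_char_ne_2 H8_3 \<Rightarrow> 'k H8_2"
  is "lin_ext scalar_2 (\<lambda>m. case m of Adt (a, b, c) \<Rightarrow> scalar_2 (haar c) * (a \<otimes> b))"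
  by (rule trilinear_ext_cong[OF H8_2.scalar_map_axioms])
    (simp_all add: haar_add haar_scale H8_2.\<iota>_add tensor_2_add_left tensor_2_add_right
      tensor_2_scale_left tensor_2_scale_right H8_2.swap[where a = 1, simplified] algebra_simps)

lemma id_id_haar_add: "id_id_haar (S + T) = id_id_haar S + id_id_haar T"
  by transfer (rule H8_2.ext_add)

lemma id_id_haar_zero: "id_id_haar 0 = 0"
  by transfer simp

lemma id_id_haar_tensor: "id_id_haar (tensor_3 a b c) = scalar_2 (haar c) * (a \<otimes> b)"
  unfolding tensor_3_def id_id_haar.abs_eq by (simp add: pure_3_def H8_2.\<iota>_one)

lemma id_haar_tensor_mult: "id_haar ((a \<otimes> 1) * T * (b \<otimes> 1)) = a * id_haar T * b"
  by (induction T rule: H8_2_induct)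
    (simp_all add: id_haar_zero id_haar_add id_haar_tensor tensor_2_mult distrib_left distrib_right
      H8.\<iota>_central mult.assoc)

text \<open>Factors in the sliced leg can be cycled because \<open>haar\<close> is a trace.\<close>

lemma id_haar_commute: "id_haar ((1 \<otimes> a) * T) = id_haar (T * (1 \<otimes> a))"
  by (induction T rule: H8_2_induct)
    (simp_all add: id_haar_zero id_haar_add id_haar_tensor tensor_2_mult distrib_left distrib_right
      haar_commute[of a])

lemma H8_2_scalar_left_commute: "S * (scalar_2 c * T) = scalar_2 c * (S * T)"
  by (metis H8_2.\<iota>_central mult.assoc)

text \<open>Invariance of the Haar functional. A group-like g other than 1 is killed on both sides;
  for a monomial containing z, every second tensor factor of its coproduct contains z, so both sides
  vanish.\<close>

lemma id_haar_comul: "id_haar (comul h) = (scalar_H8 (haar h) :: 'k::field_char_ne_2 H8)"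
proof -
  have "h \<in> H8_span" by (rule H8_span_UNIV)
  then show ?thesis
  proof induction
    case (basis b)
    have [simp]: "comul 1 = (1 \<otimes> 1 :: 'k H8_2)"
      using comul_scalar[of 1] by (simp add: H8.\<iota>_one H8_2.\<iota>_one tensor_2_one)
    note haar_eval = haar_def crossed_of_H8_mult crossed_of_H8_gen crossed_of_H8_one one_crossed_def
    show ?case
      using basis
      by (auto simp: comul_mult comul_gen tensor_2_mult distrib_left distrib_right
          right_diff_distrib left_diff_distrib id_haar_scale id_haar_add id_haar_diff id_haar_tensor
          H8_2_scalar_left_commute haar_one haar_eval H8.\<iota>_zero H8.\<iota>_one)
  next
    case (add a b)
    then show ?case by (simp add: comul_add id_haar_add haar_add H8.\<iota>_add)
  next
    case (scale a c)
    then show ?case by (simp add: comul_scale id_haar_scale haar_scale H8.\<iota>_mult)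
  qed
qed

lemma tensor_2_zero: "0 \<otimes> b = 0" "a \<otimes> 0 = 0"
  using tensor_2_add_left[of 0 0 b] tensor_2_add_right[of a 0 0] by simp_all

lemma id_tensor_comul_add: "id_tensor_comul (S + T) = id_tensor_comul S + id_tensor_comul T"
  by transfer (rule H8_3.ext_add)
lemma id_tensor_comul_zero: "id_tensor_comul 0 = 0"
  by transfer simp

lemma id_id_haar_tensor_1_2: "id_id_haar (tensor_1_2 a T) = a \<otimes> id_haar T"
proof (induction T rule: H8_2_induct)
  case zero
  have "tensor_1_2 a 0 = 0" using tensor_1_2_linear(2)[of a 0 0] by simp
  then show ?case by (simp add: id_id_haar_zero id_haar_zero tensor_2_zero)
next
  case (add T b c)
  then show ?case
    by (simp add: tensor_1_2_linear leg_tensor id_id_haar_add id_haar_add id_id_haar_tensor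
        id_haar_tensor tensor_2_scale_right tensor_2_add_right)
qed

lemma id_id_haar_id_tensor_comul: "id_id_haar (id_tensor_comul T) = id_haar T \<otimes> 1"
proof (induction T rule: H8_2_induct)
  case zero
  then show ?case by (simp add: id_tensor_comul_zero id_id_haar_zero id_haar_zero tensor_2_zero)
next
  case (add T a b)
  \<comment> \<open>Invariance leaves the scalar t(b) in the second leg; it is moved to the first,
    where \<open>id_haar\<close> puts it.\<close>
  have "a \<otimes> scalar_H8 (haar b) = (scalar_H8 (haar b) * a) \<otimes> 1"
    using tensor_2_scale_right[of a "haar b" 1] by (simp add: tensor_2_scale_left)
  with add show ?case
    by (simp add: id_tensor_comul_add leg_tensor id_id_haar_add id_haar_add id_id_haar_tensor_1_2
        id_haar_comul id_haar_tensor tensor_2_add_left)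
qed

section \<open>Leg embeddings under slicing\<close>

lemma leg_12_add: "leg_12 (S + T) = leg_12 S + leg_12 T"
  by transfer (rule H8_3.ext_add)
lemma leg_12_zero: "leg_12 0 = 0"
  by transfer simp
lemma leg_13_add: "leg_13 (S + T) = leg_13 S + leg_13 T"
  by transfer (rule H8_3.ext_add)
lemma leg_13_zero: "leg_13 0 = 0"
  by transfer simp

lemma leg_12_one: "leg_12 1 = 1"
  by (simp add: leg_tensor tensor_3_one flip: tensor_2_one)

lemma leg_12_mult: "leg_12 (S * T) = leg_12 S * leg_12 T"
proof -
  have "leg_12 ((a \<otimes> b) * T) = leg_12 (a \<otimes> b) * leg_12 T" for a b
    by (induction T rule: H8_2_induct)
      (simp_all add: leg_12_zero leg_12_add leg_tensor tensor_2_mult tensor_3_mult distrib_left)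
  then show ?thesis
    by (induction S rule: H8_2_induct) (simp_all add: leg_12_zero leg_12_add distrib_right)
qed

text \<open>\<open>leg_12 S\<close> is 1 in the third leg, so slicing there is linear over the first
  two. With the right-hand version, this takes the conjugation by R out of the slice.\<close>

lemma id_id_haar_leg_12_left: "id_id_haar (leg_12 S * T) = S * id_id_haar T"
proof -
  have "id_id_haar (leg_12 (a \<otimes> b) * T) = (a \<otimes> b) * id_id_haar T" for a b
    by (induction T rule: H8_3_induct)
      (simp_all add: leg_tensor id_id_haar_zero id_id_haar_add id_id_haar_tensor tensor_3_mult distrib_left
        tensor_2_mult H8_2_scalar_left_commute mult.assoc)
  then show ?thesis
    by (induction S rule: H8_2_induct)
      (simp_all add: leg_12_zero leg_12_add id_id_haar_zero id_id_haar_add distrib_right)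
qed

lemma id_id_haar_leg_12_right: "id_id_haar (T * leg_12 S) = id_id_haar T * S"
proof -
  have "id_id_haar (T * leg_12 (a \<otimes> b)) = id_id_haar T * (a \<otimes> b)" for a b
    by (induction T rule: H8_3_induct)
      (simp_all add: leg_tensor id_id_haar_zero id_id_haar_add id_id_haar_tensor tensor_3_mult distrib_right
        tensor_2_mult H8_2_scalar_left_commute mult.assoc)
  then show ?thesis
    by (induction S rule: H8_2_induct)
      (simp_all add: leg_12_zero leg_12_add id_id_haar_zero id_id_haar_add distrib_left)
qed

lemma id_id_haar_leg_12: "id_id_haar (leg_12 T) = T"
  by (induction T rule: H8_2_induct)
    (simp_all add: leg_12_zero leg_12_add leg_tensor id_id_haar_zero id_id_haar_add
      id_id_haar_tensor haar_one H8_2.\<iota>_one)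

lemma id_id_haar_leg_13: "id_id_haar (leg_13 T) = id_haar T \<otimes> 1"
  by (induction T rule: H8_2_induct)
    (simp_all add: leg_13_zero leg_13_add leg_tensor id_id_haar_zero id_id_haar_add id_haar_zero
      id_haar_add id_id_haar_tensor id_haar_tensor tensor_2_zero tensor_2_add_left tensor_2_scale_left)

lemma unit_inv_eq:
  assumes "a * b = 1" "b * a = 1" shows "unit_inv a = b"
proof -
  have "is_unit_elt a" using assms unfolding is_unit_elt_def by blast
  then have "unit_inv a = unit_inv a * (a * b)" by (simp add: assms)
  also have "\<dots> = b" using unit_inv(2)[OF \<open>is_unit_elt a\<close>] by (simp flip: mult.assoc)
  finally show ?thesis .
qed

lemma unit_inv_leg_12:
  assumes "is_unit_elt R" shows "unit_inv (leg_12 R) = leg_12 (unit_inv R)"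
  by (rule unit_inv_eq) (simp_all add: unit_inv[OF assms] leg_12_one flip: leg_12_mult)

section \<open>Vanishing of infinitesimal \<open>R\<close>-matrices\<close>

context scalar_map
begin

text \<open>Division by 4, for the squares K * K and w * w below. The hypothesis replaces the
  assumption on the characteristic, which the locale does not make.\<close>

lemma half_half_quadruple:
  assumes "\<iota> (1/2) + \<iota> (1/2) = 1"
  shows "\<iota> (1/2) * (\<iota> (1/2) * (t + t + t + t)) = t"
proof -
  have half: "\<iota> (1/2) * (s + s) = s" for s
    using assms by (metis distrib_left distrib_right mult_1)
  have "t + t + t + t = (t + t) + (t + t)" by (simp add: add.assoc)
  then show ?thesis by (simp only: half)
qed

end

text \<open>Commutation is checked on x, y, z. In each case a coproduct is completed next to \<chi>,
  moved across it, and the surplus second-leg factor is cycled round by the trace.\<close>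

lemma id_haar_central:
  assumes "\<And>h. \<chi> * comul h = comul h * \<chi>"
  shows "id_haar \<chi> * h = h * (id_haar \<chi> :: 'k::field_char_ne_2 H8)"
proof -
  \<comment> \<open>The parameter \<open>a\<close> is needed at x, which the coproduct of z brings
    into the second leg.\<close>
  define u where "u a = id_haar ((1 \<otimes> a) * \<chi>)" for a :: "'k H8"
  have u1: "u 1 = id_haar \<chi>" by (simp add: u_def tensor_2_one)
  have grouplike: "u a * g = g * u a"
    if g: "comul g = g \<otimes> g" "g * g = 1" and a: "g * (a * g) = a" for g a
  proof -
    \<comment> \<open>Inserting g * g = 1 in the second leg turns g \<otimes> 1 into the coproduct
      of g times 1 \<otimes> g.\<close>
    have "u a * g = id_haar ((1 \<otimes> a) * (\<chi> * (g \<otimes> g)) * (1 \<otimes> g))"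
    proof -
      have "(1 \<otimes> a) * (\<chi> * (g \<otimes> g)) * (1 \<otimes> g) = (1 \<otimes> 1) * ((1 \<otimes> a) * \<chi>) * (g \<otimes> 1)"
        by (simp add: mult.assoc tensor_2_mult g tensor_2_one)
      then show ?thesis by (simp only: id_haar_tensor_mult u_def mult_1)
    qed
    also have "\<dots> = id_haar ((1 \<otimes> g) * ((1 \<otimes> a) * ((g \<otimes> g) * \<chi>)))"
      using assms[of g] by (simp add: g id_haar_commute)
    also have "(1 \<otimes> g) * ((1 \<otimes> a) * ((g \<otimes> g) * \<chi>)) = (g \<otimes> 1) * ((1 \<otimes> a) * \<chi>) * (1 \<otimes> 1)"
      by (simp add: tensor_2_mult a tensor_2_one flip: mult.assoc) (simp add: mult.assoc a)
    also have "id_haar \<dots> = g * u a" by (simp only: id_haar_tensor_mult u_def mult_1_right)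
    finally show ?thesis .
  qed
  have cx: "comul x\<^sub>8 = (x\<^sub>8 \<otimes> x\<^sub>8 :: 'k H8_2)" and cy: "comul y\<^sub>8 = (y\<^sub>8 \<otimes> y\<^sub>8 :: 'k H8_2)"
    by (simp_all add: comul_gen)
  have x: "u 1 * x\<^sub>8 = x\<^sub>8 * u 1" by (rule grouplike) (simp_all add: cx H8_xx)
  have y: "u a * y\<^sub>8 = y\<^sub>8 * u a" if "a \<in> {1, x\<^sub>8}" for a
    using that by (intro grouplike) (auto simp add: cy H8_normal)
  have z: "u 1 * z\<^sub>8 = z\<^sub>8 * u 1"
  proof -
    let ?h = "scalar_2 (1/2) :: 'k H8_2"
    have quarter: "scalar_H8 (1/2) * (scalar_H8 (1/2) * (a + a + a + a)) = a" for a :: "'k H8"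
      by (rule H8.half_half_quadruple) (simp only: H8.\<iota>_add[symmetric] half_double H8.\<iota>_one)
    have quarter_2: "?h * (?h * (a + a + a + a)) = a" for a
      by (rule H8_2.half_half_quadruple) (simp only: H8_2.\<iota>_add[symmetric] half_double H8_2.\<iota>_one)
    \<comment> \<open>\<open>v\<close> is the inverse of z: w below is 2 z^2 and w * w = 4, so z^4 =
      1.\<close>
    define v where "v = z\<^sub>8 * (z\<^sub>8 * (z\<^sub>8 :: 'k H8))"
    define w where "w = (1 + x\<^sub>8 + y\<^sub>8 - x\<^sub>8 * y\<^sub>8 :: 'k H8)"
    have ww: "w * w = 1 + 1 + 1 + 1"
      by (simp add: w_def H8_normal algebra_simps)
    have "(z\<^sub>8 * z\<^sub>8) * (z\<^sub>8 * z\<^sub>8) = scalar_H8 (1/2) * (scalar_H8 (1/2) * (w * w))"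
      unfolding H8_zz w_def[symmetric] by (metis H8.\<iota>_central mult.assoc)
    also have "\<dots> = 1" unfolding ww by (rule quarter)
    finally have zv: "z\<^sub>8 * v = 1" "v * z\<^sub>8 = 1" by (simp_all add: v_def mult.assoc)
    define K where "K = (1 \<otimes> 1 + y\<^sub>8 \<otimes> 1 + 1 \<otimes> x\<^sub>8 - y\<^sub>8 \<otimes> x\<^sub>8 :: 'k H8_2)"
    have KK: "K * K = 1 + 1 + 1 + 1"
      by (simp add: K_def tensor_2_mult H8_normal tensor_2_one algebra_simps)
    have cz: "comul z\<^sub>8 = ?h * ((z\<^sub>8 \<otimes> z\<^sub>8) * K)" by (simp add: comul_gen K_def)
    have slice: "id_haar ((a \<otimes> c) * (\<chi> * (b \<otimes> d))) = a * u (d * c) * b" for a b c d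
    proof -
      have "(a \<otimes> c) * (\<chi> * (b \<otimes> d)) = (a \<otimes> 1) * ((1 \<otimes> c) * (\<chi> * (1 \<otimes> d))) * (b \<otimes> 1)"
        by (simp add: mult.assoc tensor_2_mult) (simp add: tensor_2_mult flip: mult.assoc)
      also have "id_haar \<dots> = a * id_haar ((1 \<otimes> c) * \<chi> * (1 \<otimes> d)) * b"
        unfolding id_haar_tensor_mult by (simp only: mult.assoc)
      also have "id_haar ((1 \<otimes> c) * \<chi> * (1 \<otimes> d)) = u (d * c)"
        unfolding id_haar_commute[symmetric] by (simp add: u_def tensor_2_mult flip: mult.assoc)
      finally show ?thesis .
    qed
    have yu: "u 1 * y\<^sub>8 = y\<^sub>8 * u 1" "u x\<^sub>8 * y\<^sub>8 = y\<^sub>8 * u x\<^sub>8" using y by auto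
    \<comment> \<open>Since y commutes with u(1) and u(x), the slice collects the coefficients of K
      * K = 4, leaving 4 u(1).\<close>
    have "id_haar (K * (\<chi> * K)) = u 1 + u 1 + u 1 + u 1"
      by (simp add: K_def distrib_left distrib_right right_diff_distrib left_diff_distrib
          id_haar_add id_haar_diff slice H8_normal yu)
    then have KchiK: "id_haar (?h * (?h * (K * (\<chi> * K)))) = u 1"
      by (simp only: id_haar_scale quarter)
    note h_commute = H8_2_scalar_left_commute[of \<chi> "1/2"] H8_2_scalar_left_commute[of K "1/2"]
      H8_2_scalar_left_commute[of "z\<^sub>8 \<otimes> z\<^sub>8" "1/2"]
    \<comment> \<open>As K * K = 4, z \<otimes> 1 is the coproduct of z times (1/2) K (1 \<otimes>
      v). Moving that coproduct across \<chi> leaves \<chi> between two copies of K.\<close>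
    have "\<chi> * (z\<^sub>8 \<otimes> 1) = \<chi> * ((z\<^sub>8 \<otimes> z\<^sub>8) * (?h * (?h * (K * K)) * (1 \<otimes> v)))"
      by (simp only: KK quarter_2) (simp add: tensor_2_mult zv)
    also have "\<dots> = \<chi> * comul z\<^sub>8 * (?h * (K * (1 \<otimes> v)))"
      by (simp add: cz mult.assoc h_commute)
    also have "\<dots> = (z\<^sub>8 \<otimes> z\<^sub>8) * (?h * (?h * (K * (\<chi> * K)))) * (1 \<otimes> v)"
      unfolding assms by (simp add: cz mult.assoc h_commute)
    finally have "id_haar (\<chi> * (z\<^sub>8 \<otimes> 1)) =
        id_haar ((1 \<otimes> v) * ((z\<^sub>8 \<otimes> z\<^sub>8) * (?h * (?h * (K * (\<chi> * K))))))"
      by (simp only: id_haar_commute)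
    also have "\<dots> = id_haar ((z\<^sub>8 \<otimes> 1) * (?h * (?h * (K * (\<chi> * K)))) * (1 \<otimes> 1))"
      by (simp add: tensor_2_mult zv tensor_2_one flip: mult.assoc)
    also have "\<dots> = z\<^sub>8 * u 1" by (simp only: id_haar_tensor_mult KchiK mult_1_right)
    also have "id_haar (\<chi> * (z\<^sub>8 \<otimes> 1)) = u 1 * z\<^sub>8"
      using id_haar_tensor_mult[of 1 \<chi> "z\<^sub>8"] by (simp add: tensor_2_one u1)
    finally show ?thesis .
  qed
  show ?thesis
  proof (induction h rule: H8_induct)
    case (scalar c)
    then show ?case by (metis H8.\<iota>_central)
  next
    case (add a b)
    then show ?case by (simp add: distrib_left distrib_right)
  next
    case (gen g a)
    have "u 1 * gen_H8 g = gen_H8 g * u 1" using x y z by (cases g) simp_all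
    then show ?case using gen unfolding u1 by (metis mult.assoc)
  qed
qed

lemma central_tensor_one_commute:
  assumes "\<And>h. u * h = h * u"
  shows "(u \<otimes> 1) * T = T * (u \<otimes> 1)"
  by (induction T rule: H8_2_induct) (simp_all add: tensor_2_mult distrib_left distrib_right assms)

theorem theorem4p13:
  fixes R \<chi> :: "'k::field_char_ne_2 H8_2"
  assumes "quasitriangular_structure R"
    and "infinitesimal_R_matrix R \<chi>"
  shows "\<chi> = 0"
proof -
  have R: "is_unit_elt R" using assms(1) by (simp add: quasitriangular_structure_def)
  have comm: "\<chi> * comul h = comul h * \<chi>" for h
    using assms(2) by (simp add: infinitesimal_R_matrix_def)
  define U where "U = id_haar \<chi> \<otimes> 1"
  have "U = id_id_haar (id_tensor_comul \<chi>)"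
    by (simp add: U_def id_id_haar_id_tensor_comul)
  \<comment> \<open>The first summand of the axiom returns \<chi> by t(1) = 1. In the second, the
    factors from R come out of the slice and \<open>leg_13 \<chi>\<close> becomes U.\<close>
  also have "\<dots> = \<chi> + unit_inv R * U * R"
    using assms(2)
    by (simp add: infinitesimal_R_matrix_def unit_inv_leg_12[OF R] id_id_haar_add
        id_id_haar_leg_12 id_id_haar_leg_12_left id_id_haar_leg_12_right id_id_haar_leg_13 U_def)
  also have "unit_inv R * U * R = U"
    unfolding U_def mult.assoc central_tensor_one_commute[OF id_haar_central[OF comm]]
    by (simp add: unit_inv(2)[OF R] flip: mult.assoc)
  finally show "\<chi> = 0" by simp
qed

end
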